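(* Assume there exists a feasible point $M$ of the problem (P) described in the context such that $(M_t)_{ij}>0$ whenever $(A_t)_{ij}>0$. Let $f$ be the function defined in the context. Then the entropic proximal-point algorithm applied to $f$, that is, the iteration $$\eta^{j}\in\arg\min_{\eta\ge0}\big\{f(\eta)+\epsilon_j\,\mathcal D(\eta\,|\,\eta^{j-1})\big\},\qquad j=1,2,\dots,$$ where $\epsilon_j>0$, converges to a minimizer of $f$. Moreover, with $\hat\eta$ denoting the current iterate, the minimizer in the proximal step is given by $\eta^*=\overline C M_0^*\mathbf 1$, where $M^*=(M_0^*,\dots,M_{T-1}^* )$ is the solution of $$\min_{M_0,\dots,M_{T-1}\ge0}\ \mathcal D\big(M_0\,|\,\operatorname{diag}(C^\top\rho_0+\overline C^\top\hat\eta)A_0\big)+\sum_{t=1}^{T-1}\mathcal D\big(M_t\,|\,\operatorname{diag}(M_t\mathbf 1)A_t\big)$$ subject to the constraints (i), (ii), (iii) of the context.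
   Context: Setting. Let $n,T\ge1$ be integers and let $A_0,\dots,A_{T-1}\in\mathbb{R}^{n\times n}_{\ge0}$ be row-stochastic matrices ($A_t\mathbf 1=\mathbf 1$). Let $\pi=\{\pi_1,\dots,\pi_k\}\subseteq\{1,\dots,n\}$ have $k$ elements, let $C=[e_{\pi_1},\dots,e_{\pi_k}]^\top\in\{0,1\}^{k\times n}$ be the coordinate-selection matrix of $\pi$, and let $\overline C\in\{0,1\}^{(n-k)\times n}$ be the coordinate-selection matrix of $\{1,\dots,n\}\setminus\pi$, so $C^\top C+\overline C^\top\overline C=I$. Let $\rho_0,\dots,\rho_T\in\mathbb{R}^k$ be given. Notation. $\mathbf 1$ is the all-ones vector; inequalities are entrywise; $\operatorname{supp}$ is the set of positions of nonzero entries. For nonnegative arrays $p,q$ of the same size with $\operatorname{supp}(p)\subseteq\operatorname{supp}(q)$, $\mathcal D(p\,|\,q)=\sum_i\big(p_i\log(p_i/q_i)-p_i+q_i\big)$, with $0\log 0:=0$ (terms with $p_i=q_i=0$ are $0$); if the support condition fails, $\mathcal D(p|q)=+\infty$. The proximal-point algorithm is started from a strictly positive vector $\eta^0\in\mathbb{R}^{n-k}_{>0}$. Constraints on $M_0,\dots,M_{T-1}\in\mathbb{R}^{n\times n}_{\ge0}$: (i) $CM_t\mathbf 1=\rho_t$ for $t=0,\dots,T-1$; (ii) $CM_{T-1}^\top\mathbf 1=\rho_T$; (iii) $M_t\mathbf 1=M_{t-1}^\top\mathbf 1$ for $t=1,\dots,T-1$. Problem (P): minimize $\sum_{t=0}^{T-1}\mathcal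 D\big(M_t\,|\,\operatorname{diag}(M_t\mathbf 1)A_t\big)$ over $M_t\in\mathbb{R}^{n\times n}_{\ge0}$ with $\operatorname{supp}(M_t)\subseteq\operatorname{supp}(A_t)$ subject to (i)–(iii); a feasible point is one satisfying all these constraints. Function $f$: for $\eta\in\mathbb{R}^{n-k}$, $f(\eta)$ is the infimum of $$\mathcal D\big(M_0\,|\,\operatorname{diag}(C^\top\rho_0+\overline C^\top\eta)A_0\big)+\sum_{t=1}^{T-1}\mathcal D\big(M_t\,|\,\operatorname{diag}(M_t\mathbf 1)A_t\big)$$ over $M_0,\dots,M_{T-1}\in\mathbb{R}^{n\times n}_{\ge0}$ satisfying (i)–(iii) and $\overline CM_0\mathbf 1=\eta$ (with $f(\eta)=+\infty$ if there is no such $M$, in particular if $\eta\not\ge0$).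
   Formalization: Convergence to a minimizer is proved under the added step-size condition that the sum of 1/ε_j diverges (it can fail otherwise), and the formula η* = C̄M_0*1 is stated for the proximal step with parameter ε = 1, since the problem for M* contains no ε and the formula fails for other ε. *)

theory Defs
  imports
    "HOL-Library.Extended_Real"
    "Jordan_Normal_Form.Matrix"
begin

text \<open>Indices run from \<open>0\<close>: coordinates over \<open>{..<n}\<close>, and the selected set \<open>\<pi>\<close> is given by
  the duplicate-free list \<open>ps\<close> of its elements, so \<open>k = length ps\<close>. A family of matrices
  \<open>M\<^sub>0, \<dots>, M\<^sub>T\<^sub>-\<^sub>1\<close> is a function on \<open>nat\<close> of which only the values below \<open>T\<close> matter.\<close>

definition ones_vec :: "nat \<Rightarrow> real vec" where
  "ones_vec n = Matrix.vec n (\<lambda>_. 1)"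

definition pos_vec :: "nat \<Rightarrow> real vec \<Rightarrow> bool" where
  "pos_vec m v \<longleftrightarrow> v \<in> carrier_vec m \<and> (\<forall>i<m. 0 < v $ i)"

definition vec_tendsto :: "nat \<Rightarrow> (nat \<Rightarrow> real vec) \<Rightarrow> real vec \<Rightarrow> bool" where
  "vec_tendsto m x l \<longleftrightarrow> (\<forall>i<m. (\<lambda>j. x j $ i) \<longlonglongrightarrow> l $ i)"

definition row_stochastic :: "nat \<Rightarrow> real mat \<Rightarrow> bool" where
  "row_stochastic n A \<longleftrightarrow>
     A \<in> carrier_mat n n \<and> 0\<^sub>m n n \<le> A \<and> A *\<^sub>v ones_vec n = ones_vec n"

definition selection_mat :: "nat \<Rightarrow> nat list \<Rightarrow> real mat" where
  "selection_mat n is = mat_of_rows n (map (unit_vec n) is)"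

text \<open>The matrices \<open>C\<close> and \<open>Cbar\<close>.\<close>

definition obs_mat :: "nat \<Rightarrow> nat list \<Rightarrow> real mat" where
  "obs_mat n ps = selection_mat n ps"

definition hid_mat :: "nat \<Rightarrow> nat list \<Rightarrow> real mat" where
  "hid_mat n ps = selection_mat n (filter (\<lambda>i. i \<notin> set ps) [0..<n])"

text \<open>The divergence is only meant for nonnegative arguments. The conventions \<open>0 log 0 = 0\<close> and
  \<open>0\<close> for terms with \<open>p\<^sub>i = q\<^sub>i = 0\<close> come from \<open>0 * x = 0\<close>.\<close>

definition KL :: "'i set \<Rightarrow> ('i \<Rightarrow> real) \<Rightarrow> ('i \<Rightarrow> real) \<Rightarrow> ereal" where
  "KL I p q = (if \<forall>i\<in>I. p i \<noteq> 0 \<longrightarrow> q i \<noteq> 0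
     then ereal (\<Sum>i\<in>I. p i * ln (p i / q i) - p i + q i) else \<infinity>)"

definition KL_vec :: "real vec \<Rightarrow> real vec \<Rightarrow> ereal" where
  "KL_vec p q = KL {..<dim_vec p} (\<lambda>i. p $ i) (\<lambda>i. q $ i)"

definition KL_mat :: "real mat \<Rightarrow> real mat \<Rightarrow> ereal" where
  "KL_mat P Q = KL ({..<dim_row P} \<times> {..<dim_col P}) (\<lambda>ij. P $$ ij) (\<lambda>ij. Q $$ ij)"

definition diag_of_vec :: "real vec \<Rightarrow> real mat" where
  "diag_of_vec v = mat_diag (dim_vec v) (\<lambda>i. v $ i)"

definition flow_constraints ::
  "nat \<Rightarrow> nat \<Rightarrow> nat list \<Rightarrow> (nat \<Rightarrow> real vec) \<Rightarrow> (nat \<Rightarrow> real mat) \<Rightarrow> bool" where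
  "flow_constraints n T ps \<rho> M \<longleftrightarrow>
     (\<forall>t<T. M t \<in> carrier_mat n n \<and> 0\<^sub>m n n \<le> M t) \<and>
     (\<forall>t<T. obs_mat n ps *\<^sub>v (M t *\<^sub>v ones_vec n) = \<rho> t) \<and>
     obs_mat n ps *\<^sub>v (transpose_mat (M (T - 1)) *\<^sub>v ones_vec n) = \<rho> T \<and>
     (\<forall>t. 1 \<le> t \<and> t < T \<longrightarrow>
        M t *\<^sub>v ones_vec n = transpose_mat (M (t - 1)) *\<^sub>v ones_vec n)"

text \<open>Feasible points of the problem of minimizing
  \<open>\<Sum>t<T. D(M\<^sub>t | diag(M\<^sub>t 1) A\<^sub>t)\<close>.\<close>

definition feasible_P ::
  "nat \<Rightarrow> nat \<Rightarrow> nat list \<Rightarrow> (nat \<Rightarrow> real mat) \<Rightarrow> (nat \<Rightarrow> real vec) \<Rightarrow> (nat \<Rightarrow> real mat) \<Rightarrow> bool" where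
  "feasible_P n T ps A \<rho> M \<longleftrightarrow>
     flow_constraints n T ps \<rho> M \<and>
     (\<forall>t<T. \<forall>i<n. \<forall>j<n. M t $$ (i, j) \<noteq> 0 \<longrightarrow> A t $$ (i, j) \<noteq> 0)"

text \<open>\<open>D(M\<^sub>0 | diag(C\<^sup>T \<rho>\<^sub>0 + Cbar\<^sup>T \<eta>) A\<^sub>0) + \<Sum>t=1..T-1. D(M\<^sub>t | diag(M\<^sub>t 1) A\<^sub>t)\<close>\<close>

definition flow_cost ::
  "nat \<Rightarrow> nat \<Rightarrow> nat list \<Rightarrow> (nat \<Rightarrow> real mat) \<Rightarrow> (nat \<Rightarrow> real vec) \<Rightarrow> real vec \<Rightarrow>
   (nat \<Rightarrow> real mat) \<Rightarrow> ereal" where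
  "flow_cost n T ps A \<rho> \<eta> M =
     KL_mat (M 0)
       (diag_of_vec (transpose_mat (obs_mat n ps) *\<^sub>v \<rho> 0 + transpose_mat (hid_mat n ps) *\<^sub>v \<eta>) * A 0)
     + (\<Sum>t=1..<T. KL_mat (M t) (diag_of_vec (M t *\<^sub>v ones_vec n) * A t))"

definition hid_marginal :: "nat \<Rightarrow> nat list \<Rightarrow> (nat \<Rightarrow> real mat) \<Rightarrow> real vec" where
  "hid_marginal n ps M = hid_mat n ps *\<^sub>v (M 0 *\<^sub>v ones_vec n)"

text \<open>The function \<open>f\<close>; the infimum over the empty set is \<open>\<infinity>\<close> in \<open>ereal\<close>.\<close>

definition reduced_cost ::
  "nat \<Rightarrow> nat \<Rightarrow> nat list \<Rightarrow> (nat \<Rightarrow> real mat) \<Rightarrow> (nat \<Rightarrow> real vec) \<Rightarrow> real vec \<Rightarrow> ereal" where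
  "reduced_cost n T ps A \<rho> \<eta> =
     (INF M \<in> {M. flow_constraints n T ps \<rho> M \<and> hid_marginal n ps M = \<eta>}.
        flow_cost n T ps A \<rho> \<eta> M)"

text \<open>The set \<open>argmin {f(\<eta>) + \<epsilon> D(\<eta> | \<eta>') | \<eta> \<in> \<real>\<^sup>m, \<eta> \<ge> 0}\<close>.\<close>

definition prox_argmin ::
  "nat \<Rightarrow> (real vec \<Rightarrow> ereal) \<Rightarrow> real \<Rightarrow> real vec \<Rightarrow> real vec set" where
  "prox_argmin m f \<epsilon> \<eta>' =
     {\<eta>. is_arg_min (\<lambda>\<eta>. f \<eta> + ereal \<epsilon> * KL_vec \<eta> \<eta>')
            (\<lambda>\<eta>. \<eta> \<in> carrier_vec m \<and> 0\<^sub>v m \<le> \<eta>) \<eta>}"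

definition prox_sequence ::
  "nat \<Rightarrow> (real vec \<Rightarrow> ereal) \<Rightarrow> (nat \<Rightarrow> real) \<Rightarrow> real vec \<Rightarrow> (nat \<Rightarrow> real vec) \<Rightarrow> bool" where
  "prox_sequence m f \<epsilon> \<eta>0 \<eta> \<longleftrightarrow>
     \<eta> 0 = \<eta>0 \<and> (\<forall>j\<ge>1. \<eta> j \<in> prox_argmin m f (\<epsilon> j) (\<eta> (j - 1)))"

end

theory Submission
  imports Defs
begin

text \<open>Since every \<open>A\<^sub>0\<close> row sums to one, the chain rule turns the modified first term into
  \<open>D(M\<^sub>0 | diag(M\<^sub>0 1) A\<^sub>0) + D(Cbar M\<^sub>0 1 | \<eta>)\<close>, so a proximal step amounts to minimizing
  \<open>F(M) + \<epsilon> D(L M | \<eta>)\<close> over the flows \<open>M\<close>, where \<open>F\<close> is the objective of (P) and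
  \<open>L M = Cbar M\<^sub>0 1\<close>. The infinite slope of the entropy at \<open>0\<close>, tested against the positive feasible
  point, keeps the iterates positive; the three-point inequality for Bregman divergences then gives
  Fejer monotonicity and convergence as soon as \<open>F\<close> has a minimizer. The total mass is not bounded
  on the feasible set, so sublevel sets of \<open>F\<close> need not be compact: mass can be lost only into states
  from which \<open>A\<close> never reaches an observed state. Elsewhere the cost bounds the mass, and inside
  this trap one may delete the initial mass and let the rest follow \<open>A\<close> without increasing \<open>F\<close>.\<close>

section \<open>The scalar divergence\<close>

text \<open>The function \<open>f\<close> is an infimum that may be \<open>\<infinity>\<close>, and
  neither its attainment nor its subgradients are convenient. So everything is proved for flows: on
  the fibre \<open>hid_marginal n ps M = \<eta>\<close> the cost is just \<open>F M\<close>, and a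
  bound valid for every flow of a fibre passes to the infimum. The three-point inequality used in
  this way yields a one-point argmin.

  The number \<open>1 / \<epsilon> j\<close> acts as a step length: the gap in value times the sum
  of the step lengths stays below the initial divergence. Convergence is therefore claimed when
  these lengths have infinite sum. The proximal step is identified with the flow problem for
  parameter 1, because the chain rule produces the divergence of the hidden marginal with
  coefficient 1.

  An obstacle to limits of \<open>F\<close> is that \<open>kl\<close> is discontinuous at the origin
  as a function of both arguments; the inequality between an entry and its row mass removes
  it.\<close>

definition kl :: "real \<Rightarrow> real \<Rightarrow> real" where
  "kl x y = x * ln (x / y) - x + y"

lemma kl_zero_left [simp]: "kl 0 y = y"
  by (simp add: kl_def)

lemma kl_refl [simp]: "kl x x = 0"
  by (simp add: kl_def)

text \<open>As a function of \<open>x\<close>, the left side is the tangent of \<open>kl\<close> at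
  \<open>x = c * y\<close>; it is also linear in the pair \<open>(x, y)\<close>. Suitable values of
  \<open>c\<close> give nonnegativity, joint convexity, the Hellinger bound and the mass bound for
  flows.\<close>

lemma kl_ge_tangent:
  assumes "0 \<le> x" "0 \<le> y" "x \<noteq> 0 \<longrightarrow> y \<noteq> 0" "0 < c"
  shows "x * ln c + y - y * c \<le> kl x y"
proof (cases "x = 0")
  case False
  then have pos: "0 < x" "0 < y" using assms by auto
  have "ln (y * c / x) \<le> y * c / x - 1"
    using pos assms by (intro ln_le_minus_one) simp
  moreover have "ln (y * c / x) = ln c - ln (x / y)"
    using pos assms by (simp add: ln_mult ln_div)
  ultimately have "x * (ln c - ln (x / y)) \<le> x * (y * c / x - 1)"
    using pos by (intro mult_left_mono) auto
  also have "\<dots> = y * c - x" using pos by (simp add: field_simps)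
  finally show ?thesis by (simp add: kl_def algebra_simps)
qed (use assms in \<open>simp add: kl_def\<close>)

lemma kl_gt_tangent:
  assumes "0 \<le> x" "0 < y" "0 < c" "x \<noteq> c * y"
  shows "x * ln c + y - y * c < kl x y"
proof (cases "x = 0")
  case False
  then have pos: "0 < x" "0 < y" using assms by auto
  have "ln (y * c / x) \<noteq> y * c / x - 1"
  proof
    assume "ln (y * c / x) = y * c / x - 1"
    then have "y * c / x = 1" using pos assms by (intro ln_eq_minus_one) auto
    then show False using pos assms by (simp add: field_simps)
  qed
  moreover have "ln (y * c / x) \<le> y * c / x - 1"
    using pos assms by (intro ln_le_minus_one) simp
  moreover have "ln (y * c / x) = ln c - ln (x / y)"
    using pos assms by (simp add: ln_mult ln_div)
  ultimately have "x * (ln c - ln (x / y)) < x * (y * c / x - 1)"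
    using pos by (intro mult_strict_left_mono) auto
  also have "\<dots> = y * c - x" using pos by (simp add: field_simps)
  finally show ?thesis by (simp add: kl_def algebra_simps)
qed (use assms in \<open>simp add: kl_def\<close>)

lemma kl_nonneg:
  assumes "0 \<le> x" "0 \<le> y" "x \<noteq> 0 \<longrightarrow> y \<noteq> 0"
  shows "0 \<le> kl x y"
  using kl_ge_tangent[OF assms, of 1] by simp

text \<open>Both points are tested against one tangent, the one that touches at the mixed point. It
  does not exist when the mixed first coordinate is 0, hence the case split.\<close>

lemma kl_convex:
  assumes "0 \<le> x" "0 \<le> y" "x \<noteq> 0 \<longrightarrow> y \<noteq> 0"
    and "0 \<le> x'" "0 \<le> y'" "x' \<noteq> 0 \<longrightarrow> y' \<noteq> 0"
    and s: "0 \<le> s" "s \<le> 1"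
  shows "kl ((1 - s) * x + s * x') ((1 - s) * y + s * y') \<le> (1 - s) * kl x y + s * kl x' y'"
proof -
  define p q where "p = (1 - s) * x + s * x'" and "q = (1 - s) * y + s * y'"
  have nn: "0 \<le> (1 - s) * x" "0 \<le> s * x'" "0 \<le> (1 - s) * y" "0 \<le> s * y'"
    using assms by auto
  show ?thesis
  proof (cases "p = 0")
    case True
    then have z: "(1 - s) * x = 0" "s * x' = 0" using nn unfolding p_def by linarith+
    have "(1 - s) * kl x y = (1 - s) * x * (ln (x / y) - 1) + (1 - s) * y"
      "s * kl x' y' = s * x' * (ln (x' / y') - 1) + s * y'"
      by (simp_all add: kl_def algebra_simps)
    then have "(1 - s) * kl x y + s * kl x' y' = q"
      by (simp only: z q_def mult_zero_left add_0)
    then show ?thesis using True by (simp flip: p_def q_def)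
  next
    case False
    then have p: "0 < p" using nn unfolding p_def by linarith
    have q: "0 < q"
    proof (rule ccontr)
      assume "\<not> 0 < q"
      then have "(1 - s) * y = 0" "s * y' = 0" using nn unfolding q_def by linarith+
      then have "(1 - s) * x = 0" "s * x' = 0" using assms by auto
      then have "p = 0" by (simp only: p_def add_0)
      then show False using p by simp
    qed
    let ?c = "p / q"
    have c: "0 < ?c" using p q by simp
    have "(1 - s) * (x * ln ?c + y - y * ?c) \<le> (1 - s) * kl x y"
      using assms c by (intro mult_left_mono kl_ge_tangent) auto
    moreover have "s * (x' * ln ?c + y' - y' * ?c) \<le> s * kl x' y'"
      using assms c by (intro mult_left_mono kl_ge_tangent) auto
    moreover have "(1 - s) * (x * ln ?c + y - y * ?c) + s * (x' * ln ?c + y' - y' * ?c)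
        = p * ln ?c + q - q * ?c"
      unfolding p_def q_def by (simp only: algebra_simps)
    moreover have "q * ?c = p" using q by simp
    ultimately show ?thesis unfolding p_def[symmetric] q_def[symmetric] kl_def by linarith
  qed
qed

text \<open>Strictness requires a common \<open>y\<close>, because \<open>kl\<close> is linear along
  rays of the pair. Uniqueness of the flow uses this once the row masses are known to agree.\<close>

lemma kl_midpoint_less:
  assumes "0 \<le> x" "0 \<le> x'" "0 < y" "x \<noteq> x'"
  shows "kl ((x + x') / 2) y < (kl x y + kl x' y) / 2"
proof -
  define p c where "p = (x + x') / 2" and "c = p / y"
  have p: "0 < p" using assms by (auto simp: p_def)
  have "0 < c" "c * y = p" using assms p by (auto simp: c_def)
  moreover have "x \<noteq> p" "x' \<noteq> p" using assms by (auto simp: p_def)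
  ultimately have "x * ln c + y - y * c < kl x y" "x' * ln c + y - y * c < kl x' y"
    using assms by (auto intro!: kl_gt_tangent)
  moreover have "x * ln c + x' * ln c = 2 * (p * ln c)"
    by (simp add: p_def algebra_simps)
  ultimately show ?thesis
    using \<open>c * y = p\<close> unfolding p_def[symmetric] kl_def[of p y] c_def[symmetric]
    by (simp add: mult.commute)
qed

text \<open>The tangent with \<open>c = sqrt x / sqrt y\<close> halves the logarithm. Square roots
  turn small or bounded divergence into statements about coordinates that stay uniform down to
  0.\<close>

lemma kl_ge_hellinger:
  assumes "0 \<le> x" "0 < y"
  shows "(sqrt x - sqrt y)\<^sup>2 \<le> kl x y"
proof (cases "x = 0")
  case False
  then have x: "0 < x" using assms by simp
  have "x * ln (sqrt x / sqrt y) + y - y * (sqrt x / sqrt y) \<le> kl x y"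
    using x assms by (intro kl_ge_tangent) auto
  moreover have "ln (sqrt x / sqrt y) = ln (x / y) / 2"
    using x assms by (simp add: ln_sqrt flip: real_sqrt_divide)
  moreover have "y * (sqrt x / sqrt y) = sqrt x * sqrt y"
    using assms by (simp add: field_simps)
  moreover have "(sqrt x - sqrt y)\<^sup>2 = x + y - 2 * (sqrt x * sqrt y)"
    using x assms by (simp add: power2_diff)
  ultimately have "x * (ln (x / y) / 2) + y - sqrt x * sqrt y \<le> x * ln (x / y) - x + y"
    by (simp only: kl_def)
  then show ?thesis unfolding \<open>(sqrt x - sqrt y)\<^sup>2 = _\<close> kl_def by simp
qed (use assms in simp)

text \<open>Supplies the quadratic remainder when a proximal minimizer is perturbed along a
  segment.\<close>

lemma kl_le_chi_square:
  assumes "0 \<le> x" "0 < y"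
  shows "kl x y \<le> (x - y)\<^sup>2 / y"
proof (cases "x = 0")
  case False
  then have "ln (x / y) \<le> x / y - 1" using assms by (intro ln_le_minus_one) simp
  then have "x * ln (x / y) \<le> x * (x / y - 1)" using assms by (intro mult_left_mono) auto
  then have "kl x y \<le> x * (x / y - 1) - x + y" by (simp add: kl_def)
  also have "\<dots> = (x - y)\<^sup>2 / y" using assms by (simp add: field_simps power2_eq_square)
  finally show ?thesis .
qed (use assms in \<open>simp add: power2_eq_square\<close>)

text \<open>The three-point identity of a Bregman divergence; \<open>ln (u / q)\<close> is the
  derivative of \<open>kl\<close> in its first argument at \<open>u\<close>.\<close>

lemma kl_three_point:
  assumes "0 \<le> p" "0 < u" "0 < q"
  shows "kl p q - kl u q = (p - u) * ln (u / q) + kl p u"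
proof (cases "p = 0")
  case False
  then show ?thesis using assms by (simp add: kl_def ln_div algebra_simps)
qed (use assms in \<open>simp add: kl_def\<close>)

text \<open>The excess \<open>s * a * ln s\<close> over linear interpolation is the infinite slope
  of the entropy at 0 in explicit form.\<close>

lemma kl_scale:
  assumes "0 < s" "0 < a" "0 < q"
  shows "kl (s * a) q = (1 - s) * kl 0 q + s * kl a q + s * a * ln s"
  using assms by (simp add: kl_def ln_div ln_mult algebra_simps)

text \<open>Only the limit 0 is delicate, since \<open>ln\<close> is unbounded there;
  \<open>ln (1 / sqrt z) \<le> 1 / sqrt z - 1\<close> supplies the majorant
  \<open>2 * sqrt z\<close>.\<close>

lemma tendsto_xlnx:
  assumes "\<And>k. 0 \<le> x k" "x \<longlonglongrightarrow> l"
  shows "(\<lambda>k. x k * ln (x k)) \<longlonglongrightarrow> l * ln (l :: real)"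
proof (cases "l = 0")
  case True
  have bd: "\<bar>z * ln z\<bar> \<le> 2 * sqrt z" if "0 \<le> z" "z < 1" for z :: real
  proof (cases "z = 0")
    case False
    then have z: "0 < z" using that by simp
    have "ln (1 / sqrt z) \<le> 1 / sqrt z - 1" using z by (intro ln_le_minus_one) simp
    then have "- ln z \<le> 2 * (1 / sqrt z - 1)" using z by (simp add: ln_div ln_sqrt)
    then have "z * - ln z \<le> z * (2 * (1 / sqrt z - 1))" using z by (intro mult_left_mono) auto
    also have "\<dots> = 2 * sqrt z - 2 * z"
      using z by (simp add: field_simps flip: power2_eq_square)
    finally have "z * - ln z \<le> 2 * sqrt z" using z by linarith
    moreover have "z * ln z \<le> 0" using z that by (simp add: mult_nonneg_nonpos)
    ultimately show ?thesis by simp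
  qed simp
  have "(\<lambda>k. 2 * sqrt (x k)) \<longlonglongrightarrow> 2 * sqrt 0"
    using assms(2) True by (intro tendsto_intros) simp
  then have lim: "(\<lambda>k. 2 * sqrt (x k)) \<longlonglongrightarrow> 0" by simp
  have "eventually (\<lambda>k. x k < 1) sequentially"
    using order_tendstoD(2)[OF assms(2), of 1] True by simp
  then have "eventually (\<lambda>k. norm (x k * ln (x k)) \<le> 2 * sqrt (x k)) sequentially"
    by eventually_elim (use assms(1) bd in simp)
  then have "eventually (\<lambda>k. norm (x k * ln (x k)) \<le> norm (2 * sqrt (x k)) * 1) sequentially"
    by eventually_elim simp
  then have "(\<lambda>k. x k * ln (x k)) \<longlonglongrightarrow> 0" by (rule tendsto_0_le[OF lim])
  then show ?thesis using True by simp
qed (use assms in \<open>auto intro!: tendsto_intros\<close>)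

lemma tendsto_kl:
  assumes "\<And>k. 0 \<le> x k" "x \<longlonglongrightarrow> l" "y \<longlonglongrightarrow> q" "0 < q"
  shows "(\<lambda>k. kl (x k) (y k)) \<longlonglongrightarrow> kl l q"
proof -
  have eq: "kl a b = a * ln a - a * ln b - a + b" if "0 \<le> a" "0 < b" for a b
    using that by (cases "a = 0") (auto simp: kl_def ln_div algebra_simps)
  have "0 \<le> l" using assms by (intro LIMSEQ_le_const) auto
  then have "(\<lambda>k. x k * ln (x k) - x k * ln (y k) - x k + y k) \<longlonglongrightarrow> kl l q"
    using assms by (subst eq) (auto intro!: tendsto_intros tendsto_xlnx)
  moreover have "eventually (\<lambda>k. 0 < y k) sequentially"
    using order_tendstoD(1)[OF assms(3,4)] .
  then have "eventually (\<lambda>k. x k * ln (x k) - x k * ln (y k) - x k + y k = kl (x k) (y k)) sequentially"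
    by eventually_elim (simp add: eq assms)
  ultimately show ?thesis by (rule Lim_transform_eventually)
qed

text \<open>When both arguments tend to 0, the ratio \<open>x k / (y k * a)\<close> is at most
  \<open>1 / a\<close>, which keeps the logarithm bounded above. Entries, row masses and transition
  probabilities fit this pattern.\<close>

lemma tendsto_kl_scaled:
  assumes "\<And>k. 0 \<le> x k" "\<And>k. x k \<le> y k" "x \<longlonglongrightarrow> l" "y \<longlonglongrightarrow> q" "0 \<le> a"
    and "\<And>k. x k \<noteq> 0 \<Longrightarrow> a \<noteq> 0"
  shows "(\<lambda>k. kl (x k) (y k * a)) \<longlonglongrightarrow> kl l (q * a)"
proof -
  have nn: "0 \<le> l" "l \<le> q"
    using assms by (auto intro: LIMSEQ_le_const LIMSEQ_le)
  consider "a = 0" | "0 < a" "q = 0" | "0 < a" "0 < q" using nn assms by fastforce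
  then show ?thesis
  proof cases
    case 1
    then have "x = (\<lambda>_. 0)" using assms by auto
    moreover from this have "l = 0" using assms(3) by (simp add: LIMSEQ_const_iff)
    ultimately show ?thesis using 1 by simp
  next
    case 2
    then have l: "l = 0" using nn by simp
    have bd: "\<bar>kl (x k) (y k * a)\<bar> \<le> x k * ln (1 / a) - x k + y k * a" for k
    proof -
      have nonneg: "0 \<le> kl (x k) (y k * a)"
        using assms(1)[of k] assms(2)[of k] 2 by (intro kl_nonneg) auto
      have "x k * ln (x k / (y k * a)) \<le> x k * ln (1 / a)"
      proof (cases "x k = 0")
        case False
        then have "0 < x k" "0 < y k" using assms(1,2)[of k] by auto
        then show ?thesis using 2 assms(2)[of k]
          by (intro mult_left_mono ln_mono) (auto simp: field_simps)
      qed simp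
      then show ?thesis using nonneg by (simp add: kl_def)
    qed
    have "(\<lambda>k. x k * ln (1 / a) - x k + y k * a) \<longlonglongrightarrow> 0 * ln (1 / a) - 0 + 0 * a"
      using assms(3,4) 2 l by (intro tendsto_intros) auto
    then have lim: "(\<lambda>k. x k * ln (1 / a) - x k + y k * a) \<longlonglongrightarrow> 0" by simp
    have "norm (kl (x k) (y k * a)) \<le> norm (x k * ln (1 / a) - x k + y k * a) * 1" for k
      using bd[of k] by simp
    then have "(\<lambda>k. kl (x k) (y k * a)) \<longlonglongrightarrow> 0"
      by (intro tendsto_0_le[OF lim always_eventually]) blast
    then show ?thesis using 2 l by simp
  next
    case 3
    then show ?thesis using assms by (intro tendsto_kl tendsto_intros) auto
  qed
qed

section \<open>Convergent subsequences in finitely many coordinates\<close>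

lemma convergent_subseq_real:
  fixes x :: "nat \<Rightarrow> real"
  assumes "\<And>k. \<bar>x k\<bar> \<le> B"
  shows "\<exists>r l. strict_mono r \<and> (\<lambda>k. x (r k)) \<longlonglongrightarrow> l"
proof -
  obtain r :: "nat \<Rightarrow> nat" where r: "strict_mono r" "monoseq (\<lambda>k. x (r k))"
    using seq_monosub[of x] by blast
  have "Bseq (\<lambda>k. x (r k))" using assms by (intro BseqI'[of _ B]) simp
  then have "convergent (\<lambda>k. x (r k))" using r(2) by (rule Bseq_monoseq_convergent)
  then show ?thesis using r(1) unfolding convergent_def by blast
qed

lemma convergent_subseq_finite:
  fixes x :: "nat \<Rightarrow> 'a \<Rightarrow> real"
  assumes "finite I" "\<And>k i. i \<in> I \<Longrightarrow> \<bar>x k i\<bar> \<le> B"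
  shows "\<exists>r l. strict_mono r \<and> (\<forall>i\<in>I. (\<lambda>k. x (r k) i) \<longlonglongrightarrow> l i)"
  using assms
proof (induction I rule: finite_induct)
  case empty
  show ?case by (auto intro!: exI[of _ "\<lambda>k. k"] simp: strict_mono_def)
next
  case (insert a I)
  then obtain r l where r: "strict_mono r" "\<forall>i\<in>I. (\<lambda>k. x (r k) i) \<longlonglongrightarrow> l i"
    by blast
  obtain r' b where r': "strict_mono r'" "(\<lambda>k. x (r (r' k)) a) \<longlonglongrightarrow> b"
    using convergent_subseq_real[of "\<lambda>k. x (r k) a" B] insert.prems by auto
  have "(\<lambda>k. x ((r \<circ> r') k) i) \<longlonglongrightarrow> (l(a := b)) i" if "i \<in> insert a I" for i
    using that r' LIMSEQ_subseq_LIMSEQ[OF _ r'(1), of "\<lambda>k. x (r k) i" "l i"] r(2) insert.hyps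
    by (auto simp: o_def)
  moreover have "strict_mono (r \<circ> r')" using r(1) r'(1) by (rule strict_mono_o)
  ultimately show ?case by blast
qed

section \<open>The entropic proximal-point method\<close>

definition kl_sum :: "nat \<Rightarrow> (nat \<Rightarrow> real) \<Rightarrow> (nat \<Rightarrow> real) \<Rightarrow> real" where
  "kl_sum m u v = (\<Sum>i<m. kl (u i) (v i))"

lemma kl_sum_nonneg:
  assumes "\<And>i. i < m \<Longrightarrow> 0 \<le> u i" "\<And>i. i < m \<Longrightarrow> 0 < v i"
  shows "0 \<le> kl_sum m u v"
  unfolding kl_sum_def using assms by (intro sum_nonneg kl_nonneg) (force simp: less_imp_le)+

lemma kl_le_kl_sum:
  assumes "\<And>i. i < m \<Longrightarrow> 0 \<le> u i" "\<And>i. i < m \<Longrightarrow> 0 < v i" "i < m"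
  shows "kl (u i) (v i) \<le> kl_sum m u v"
  unfolding kl_sum_def using assms
  by (intro member_le_sum kl_nonneg) (force simp: less_imp_le)+

lemma kl_sum_sqrt_diff:
  assumes "\<And>i. i < m \<Longrightarrow> 0 \<le> u i" "\<And>i. i < m \<Longrightarrow> 0 < v i" "i < m"
  shows "\<bar>sqrt (u i) - sqrt (v i)\<bar> \<le> sqrt (kl_sum m u v)"
proof -
  have "(sqrt (u i) - sqrt (v i))\<^sup>2 \<le> kl (u i) (v i)"
    using assms by (intro kl_ge_hellinger) auto
  also have "\<dots> \<le> kl_sum m u v" using assms by (rule kl_le_kl_sum)
  finally show ?thesis using real_sqrt_le_mono by fastforce
qed

lemma kl_sum_eq_zero:
  assumes "\<And>i. i < m \<Longrightarrow> 0 \<le> u i" "\<And>i. i < m \<Longrightarrow> 0 < v i" "kl_sum m u v \<le> 0" "i < m"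
  shows "u i = v i"
  using kl_sum_sqrt_diff[of m u v i] kl_sum_nonneg[of m u v] assms by simp

lemma tendsto_kl_sum:
  assumes "\<And>k i. i < m \<Longrightarrow> 0 \<le> u k i" "\<And>i. i < m \<Longrightarrow> (\<lambda>k. u k i) \<longlonglongrightarrow> l i"
    and "\<And>i. i < m \<Longrightarrow> 0 < v i"
  shows "(\<lambda>k. kl_sum m (u k) v) \<longlonglongrightarrow> kl_sum m l v"
  unfolding kl_sum_def using assms by (intro tendsto_sum tendsto_kl) auto

text \<open>A limit of positive iterates may have zero coordinates, which \<open>tendsto_kl\<close>
  does not cover; there \<open>kl 0 y = y\<close> tends to 0 by itself.\<close>

lemma tendsto_kl_sum_right:
  assumes "\<And>i. i < m \<Longrightarrow> 0 \<le> l i" "\<And>i. i < m \<Longrightarrow> (\<lambda>k. v k i) \<longlonglongrightarrow> l i"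
  shows "(\<lambda>k. kl_sum m l (v k)) \<longlonglongrightarrow> 0"
proof -
  have "(\<lambda>k. kl (l i) (v k i)) \<longlonglongrightarrow> 0" if "i < m" for i
  proof (cases "l i = 0")
    case False
    then have "(\<lambda>k. kl (l i) (v k i)) \<longlonglongrightarrow> kl (l i) (l i)"
      using assms that by (intro tendsto_kl) (auto simp: less_le)
    then show ?thesis by simp
  qed (use assms(2)[OF that] in simp)
  then have "(\<lambda>k. \<Sum>i<m. kl (l i) (v k i)) \<longlonglongrightarrow> (\<Sum>i<m. 0)"
    by (intro tendsto_sum) auto
  then show ?thesis by (simp add: kl_sum_def)
qed

text \<open>The bound \<open>g + 1\<close> at every index places the whole sequence in one sublevel
  set.\<close>

lemma minimizing_sequence:
  fixes G :: "'x \<Rightarrow> real"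
  assumes "x0 \<in> K" "\<And>x. x \<in> K \<Longrightarrow> 0 \<le> G x"
  shows "\<exists>X g. (\<forall>k. X k \<in> K) \<and> (\<lambda>k. G (X k)) \<longlonglongrightarrow> g \<and> (\<forall>y\<in>K. g \<le> G y) \<and> (\<forall>k. G (X k) \<le> g + 1)"
proof -
  define g where "g = Inf (G ` K)"
  have bdd: "bdd_below (G ` K)" using assms(2) by (auto intro!: bdd_belowI[of _ 0])
  have lower: "g \<le> G y" if "y \<in> K" for y
    unfolding g_def using bdd that by (intro cInf_lower) auto
  have "\<exists>x\<in>K. G x < g + 1 / Suc k" for k
  proof -
    have "Inf (G ` K) < g + 1 / Suc k" by (simp add: g_def)
    then show ?thesis using bdd assms(1) by (subst (asm) cInf_less_iff) auto
  qed
  then obtain X where X: "\<And>k. X k \<in> K" "\<And>k. G (X k) < g + 1 / Suc k" by metis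
  have "(\<lambda>k. g + 1 / Suc k) \<longlonglongrightarrow> g + 0"
    by (intro tendsto_intros LIMSEQ_Suc[OF lim_1_over_n])
  then have "(\<lambda>k. G (X k)) \<longlonglongrightarrow> g"
    using X lower
    by (intro tendsto_sandwich[of "\<lambda>_. g" "\<lambda>k. G (X k)" sequentially "\<lambda>k. g + 1 / Suc k"]
        always_eventually allI tendsto_const) (simp_all add: less_imp_le)
  moreover have "G (X k) \<le> g + 1" for k
  proof -
    have "(1 :: real) / Suc k \<le> 1" by simp
    then show ?thesis using X(2)[of k] by linarith
  qed
  ultimately show ?thesis using X(1) lower by blast
qed

lemma le_of_le_add_small:
  fixes a b c :: real
  assumes "\<And>s. 0 < s \<Longrightarrow> s \<le> 1 \<Longrightarrow> a \<le> b + s * c"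
  shows "a \<le> b"
proof (rule field_le_epsilon)
  fix e :: real assume e: "0 < e"
  define s where "s = min 1 (e / (\<bar>c\<bar> + 1))"
  have s: "0 < s" "s \<le> 1" using e by (auto simp: s_def)
  have "s * c \<le> e / (\<bar>c\<bar> + 1) * (\<bar>c\<bar> + 1)"
    using s e by (intro order_trans[OF mult_left_mono[of c "\<bar>c\<bar> + 1"]] mult_right_mono) (auto simp: s_def)
  also have "\<dots> = e" by simp
  finally show "a \<le> b + e" using assms[OF s] by linarith
qed

text \<open>The set \<open>K\<close> carries no vector space structure, so \<open>segment\<close>
  states convexity directly, with \<open>L\<close> affine along the segment. Compactness is asked
  only under a bound on \<open>L\<close>: a proximal term provides such a bound, whereas
  \<open>F\<close> alone need not.\<close>

locale prox_problem =
  fixes K :: "'x set" and F :: "'x \<Rightarrow> real" and L :: "'x \<Rightarrow> nat \<Rightarrow> real" and m :: nat and x0 :: 'x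
  assumes F_nonneg: "x \<in> K \<Longrightarrow> 0 \<le> F x"
    and L_nonneg: "x \<in> K \<Longrightarrow> i < m \<Longrightarrow> 0 \<le> L x i"
    and x0: "x0 \<in> K" and L_x0: "i < m \<Longrightarrow> 0 < L x0 i"
    and segment: "x \<in> K \<Longrightarrow> y \<in> K \<Longrightarrow> 0 \<le> s \<Longrightarrow> s \<le> 1 \<Longrightarrow>
      \<exists>z\<in>K. (\<forall>i<m. L z i = (1 - s) * L x i + s * L y i) \<and> F z \<le> (1 - s) * F x + s * F y"
    and compact: "\<And>X :: nat \<Rightarrow> 'x. (\<And>k. X k \<in> K) \<Longrightarrow> (\<And>k i. i < m \<Longrightarrow> L (X k) i \<le> B) \<Longrightarrow>
      \<exists>r x. strict_mono r \<and> x \<in> K \<and> (\<forall>i<m. (\<lambda>k. L (X (r k)) i) \<longlonglongrightarrow> L x i) \<and>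
        (\<lambda>k. F (X (r k))) \<longlonglongrightarrow> F x"
begin

text \<open>The proximal objective is lifted from the marginal to the points above it, so that all
  costs remain real numbers.\<close>

definition prox_cost :: "real \<Rightarrow> (nat \<Rightarrow> real) \<Rightarrow> 'x \<Rightarrow> real" where
  "prox_cost e w x = F x + e * kl_sum m (L x) w"

definition prox_min :: "real \<Rightarrow> (nat \<Rightarrow> real) \<Rightarrow> 'x \<Rightarrow> bool" where
  "prox_min e w = is_arg_min (prox_cost e w) (\<lambda>x. x \<in> K)"

lemma prox_minD:
  assumes "prox_min e w x"
  shows "x \<in> K" "y \<in> K \<Longrightarrow> prox_cost e w x \<le> prox_cost e w y"
  using assms by (auto simp: prox_min_def is_arg_min_linorder)

text \<open>Stated for every \<open>e\<close> in order to serve \<open>e = 0\<close> as well, the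
  minimization of \<open>F\<close> itself.\<close>

lemma limit_is_minimizer:
  assumes X: "\<And>k. X k \<in> K" "\<And>k i. i < m \<Longrightarrow> L (X k) i \<le> B"
    and w: "\<And>i. i < m \<Longrightarrow> 0 < w i"
    and g: "(\<lambda>k. prox_cost e w (X k)) \<longlonglongrightarrow> g" "\<And>y. y \<in> K \<Longrightarrow> g \<le> prox_cost e w y"
  shows "\<exists>x. prox_min e w x"
proof -
  obtain r x where r: "strict_mono r" "x \<in> K" "\<forall>i<m. (\<lambda>k. L (X (r k)) i) \<longlonglongrightarrow> L x i"
    "(\<lambda>k. F (X (r k))) \<longlonglongrightarrow> F x"
    using compact[of X B] X by blast
  have "(\<lambda>k. prox_cost e w (X (r k))) \<longlonglongrightarrow> prox_cost e w x"
    unfolding prox_cost_def using X r w L_nonneg by (intro tendsto_intros tendsto_kl_sum) auto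
  moreover have "(\<lambda>k. prox_cost e w (X (r k))) \<longlonglongrightarrow> g"
    using LIMSEQ_subseq_LIMSEQ[OF g(1) r(1)] by (simp add: o_def)
  ultimately have "prox_cost e w x = g" by (rule LIMSEQ_unique)
  then show ?thesis using g(2) r(2) unfolding prox_min_def is_arg_min_linorder by auto
qed

lemma prox_min_exists:
  assumes "0 < e" and w: "\<And>i. i < m \<Longrightarrow> 0 < w i"
  shows "\<exists>x. prox_min e w x"
proof -
  have nn: "0 \<le> kl_sum m (L x) w" if "x \<in> K" for x
    using that w L_nonneg by (intro kl_sum_nonneg) auto
  then have "0 \<le> prox_cost e w x" if "x \<in> K" for x
    using that assms F_nonneg by (simp add: prox_cost_def)
  then obtain X g where X: "\<And>k. X k \<in> K" "(\<lambda>k. prox_cost e w (X k)) \<longlonglongrightarrow> g"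
    "\<And>y. y \<in> K \<Longrightarrow> g \<le> prox_cost e w y" "\<And>k. prox_cost e w (X k) \<le> g + 1"
    using minimizing_sequence[of x0 K "prox_cost e w"] x0 by metis
  define c where "c = (g + 1) / e"
  have c: "kl_sum m (L (X k)) w \<le> c" for k
    using X(4)[of k] F_nonneg[OF X(1)[of k]] \<open>0 < e\<close>
    by (simp add: prox_cost_def c_def field_simps)
  \<comment> \<open>The Hellinger bound gives one summand per coordinate; the sum is a bound common
    to all of them.\<close>
  define B where "B = (\<Sum>i<m. (sqrt (w i) + sqrt c)\<^sup>2)"
  have "L (X k) i \<le> B" if i: "i < m" for k i
  proof -
    have "\<bar>sqrt (L (X k) i) - sqrt (w i)\<bar> \<le> sqrt (kl_sum m (L (X k)) w)"
      using i w L_nonneg X(1) by (intro kl_sum_sqrt_diff) auto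
    also have "\<dots> \<le> sqrt c" using c by simp
    finally have "sqrt (L (X k) i) \<le> sqrt (w i) + sqrt c" by linarith
    then have "L (X k) i \<le> (sqrt (w i) + sqrt c)\<^sup>2" by (rule sqrt_le_D)
    also have "\<dots> \<le> B" unfolding B_def using i by (intro member_le_sum) auto
    finally show ?thesis .
  qed
  then show ?thesis using limit_is_minimizer[of X B w e g] X w by blast
qed

text \<open>Without a proximal term a sublevel set of \<open>F\<close> may have unbounded
  \<open>L\<close>, so the hypothesis exchanges each point for a bounded one that costs no
  more.\<close>

lemma minimizer_exists:
  assumes "\<And>c. \<exists>B. \<forall>x\<in>K. F x \<le> c \<longrightarrow> (\<exists>y\<in>K. F y \<le> F x \<and> (\<forall>i<m. L y i \<le> B))"
  shows "\<exists>x. is_arg_min F (\<lambda>x. x \<in> K) x"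
proof -
  have cost: "prox_cost 0 (\<lambda>_. 1) = F" by (simp add: prox_cost_def fun_eq_iff)
  obtain X g where X: "\<And>k. X k \<in> K" "(\<lambda>k. F (X k)) \<longlonglongrightarrow> g"
    "\<And>y. y \<in> K \<Longrightarrow> g \<le> F y" "\<And>k. F (X k) \<le> g + 1"
    using minimizing_sequence[of x0 K F] x0 F_nonneg by metis
  obtain B where "\<forall>x\<in>K. F x \<le> g + 1 \<longrightarrow> (\<exists>y\<in>K. F y \<le> F x \<and> (\<forall>i<m. L y i \<le> B))"
    using assms by blast
  then have "\<forall>k. \<exists>y\<in>K. F y \<le> F (X k) \<and> (\<forall>i<m. L y i \<le> B)" using X by blast
  then obtain Y where Y: "\<And>k. Y k \<in> K" "\<And>k. F (Y k) \<le> F (X k)" "\<And>k i. i < m \<Longrightarrow> L (Y k) i \<le> B"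
    by metis
  have "(\<lambda>k. F (Y k)) \<longlonglongrightarrow> g"
    using X(3)[OF Y(1)] Y(2) X(2)
    by (intro tendsto_sandwich[of "\<lambda>_. g" "\<lambda>k. F (Y k)" sequentially "\<lambda>k. F (X k)"]
        always_eventually allI tendsto_const)
  then show ?thesis
    using limit_is_minimizer[of Y B "\<lambda>_. 1" 0 g] Y X(3) unfolding prox_min_def cost by auto
qed

text \<open>If \<open>L x i = 0\<close>, moving from \<open>x\<close> towards \<open>x0\<close> changes the cost by at most
  \<open>s * const + e * s * a * ln s\<close>, which is negative for small \<open>s\<close>.\<close>

lemma prox_min_pos:
  assumes "0 < e" and w: "\<And>i. i < m \<Longrightarrow> 0 < w i" and x: "prox_min e w x" and i: "i < m"
  shows "0 < L x i"
proof (rule ccontr)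
  assume "\<not> 0 < L x i"
  then have z: "L x i = 0" using L_nonneg[OF prox_minD(1)[OF x] i] by simp
  define a where "a = L x0 i"
  have a: "0 < a" using L_x0 i by (simp add: a_def)
  define d where "d = prox_cost e w x0 - prox_cost e w x"
  have d: "0 \<le> d" using prox_minD(2)[OF x x0] by (simp add: d_def)
  \<comment> \<open>Chosen so that \<open>e * a * ln s = - d - e * a\<close>: the entropy gain then
    outweighs the loss \<open>s * d\<close> by \<open>s * (e * a)\<close>.\<close>
  define s where "s = exp (- (d / (e * a) + 1))"
  have "0 \<le> d / (e * a)" using d a assms by simp
  then have s: "0 < s" "s \<le> 1" by (simp_all add: s_def)
  obtain y where y: "y \<in> K" "\<forall>i<m. L y i = (1 - s) * L x i + s * L x0 i"
    "F y \<le> (1 - s) * F x + s * F x0"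
    using segment[OF prox_minD(1)[OF x] x0, of s] s by auto
  have kls: "kl (L y j) (w j) \<le> (1 - s) * kl (L x j) (w j) + s * kl (L x0 j) (w j)
      + (if j = i then s * a * ln s else 0)" if j: "j < m" for j
  proof (cases "j = i")
    case True
    then show ?thesis using y(2) i z s a w kl_scale[of s a "w i"] by (simp add: a_def)
  next
    case False
    have "kl ((1 - s) * L x j + s * L x0 j) ((1 - s) * w j + s * w j)
      \<le> (1 - s) * kl (L x j) (w j) + s * kl (L x0 j) (w j)"
      using j w[OF j] s L_nonneg prox_minD(1)[OF x] x0 by (intro kl_convex) auto
    moreover have "(1 - s) * w j + s * w j = w j" by (simp add: algebra_simps)
    ultimately show ?thesis using y(2) j False by simp
  qed
  have "kl_sum m (L y) w \<le> (\<Sum>j<m. (1 - s) * kl (L x j) (w j) + s * kl (L x0 j) (w j)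
      + (if j = i then s * a * ln s else 0))"
    unfolding kl_sum_def using kls by (intro sum_mono) auto
  also have "\<dots> = (1 - s) * kl_sum m (L x) w + s * kl_sum m (L x0) w + s * a * ln s"
    using i by (simp add: kl_sum_def sum.distrib sum_distrib_left)
  finally have "e * kl_sum m (L y) w \<le> e * ((1 - s) * kl_sum m (L x) w + s * kl_sum m (L x0) w + s * a * ln s)"
    using assms by (intro mult_left_mono) auto
  then have "prox_cost e w y \<le> prox_cost e w x + s * d + e * s * a * ln s"
    using y(3) by (simp add: prox_cost_def d_def algebra_simps)
  then have "0 \<le> s * d + e * s * a * ln s" using prox_minD(2)[OF x y(1)] by linarith
  moreover have "e * s * a * ln s = - s * d - s * (e * a)"
    using a assms by (simp add: s_def field_simps)
  moreover have "0 < s * (e * a)" using s a assms by simp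
  ultimately show False by linarith
qed

text \<open>First-order optimality without subgradients: \<open>x\<close> is compared with the point
  at fraction \<open>s\<close> on the way to \<open>y\<close>, the inequality is divided by
  \<open>s\<close>, and \<open>s\<close> tends to 0. Positivity of \<open>L x\<close> makes the
  slope \<open>ln (L x i / w i)\<close> finite and the remainder quadratic in
  \<open>s\<close>.\<close>

lemma prox_min_three_point:
  assumes "0 < e" and w: "\<And>i. i < m \<Longrightarrow> 0 < w i" and x: "prox_min e w x" and y: "y \<in> K"
  shows "prox_cost e w x + e * kl_sum m (L y) (L x) \<le> prox_cost e w y"
proof -
  have pos: "0 < L x i" if "i < m" for i using prox_min_pos[OF assms(1) w x] that by blast
  have xK: "x \<in> K" using prox_minD(1)[OF x] .
  define lin where "lin = (\<Sum>i<m. (L y i - L x i) * ln (L x i / w i))"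
  define C where "C = (\<Sum>i<m. (L y i - L x i)\<^sup>2 / L x i)"
  have "F x \<le> F y + e * lin + s * (e * C)" if s: "0 < s" "s \<le> 1" for s
  proof -
    obtain z where z: "z \<in> K" "\<forall>i<m. L z i = (1 - s) * L x i + s * L y i"
      "F z \<le> (1 - s) * F x + s * F y"
      using segment[OF xK y, of s] s by auto
    have "kl (L z i) (w i) - kl (L x i) (w i)
        \<le> s * ((L y i - L x i) * ln (L x i / w i)) + s * (s * ((L y i - L x i)\<^sup>2 / L x i))"
      if i: "i < m" for i
    proof -
      have eq: "L z i - L x i = s * (L y i - L x i)" using z(2) i by (simp add: algebra_simps)
      have "kl (L z i) (L x i) \<le> (L z i - L x i)\<^sup>2 / L x i"
        using pos[OF i] L_nonneg[OF z(1) i] by (intro kl_le_chi_square)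
      also have "\<dots> = s * (s * ((L y i - L x i)\<^sup>2 / L x i))"
        unfolding eq by (simp add: power2_eq_square)
      finally show ?thesis
        using kl_three_point[of "L z i" "L x i" "w i"] pos i w L_nonneg[OF z(1)] unfolding eq by simp
    qed
    then have "kl_sum m (L z) w - kl_sum m (L x) w
        \<le> (\<Sum>i<m. s * ((L y i - L x i) * ln (L x i / w i)) + s * (s * ((L y i - L x i)\<^sup>2 / L x i)))"
      unfolding kl_sum_def sum_subtractf[symmetric] by (intro sum_mono) auto
    also have "\<dots> = s * (lin + s * C)"
      by (simp add: lin_def C_def sum.distrib sum_distrib_left distrib_left)
    finally have "e * (kl_sum m (L z) w - kl_sum m (L x) w) \<le> e * (s * (lin + s * C))"
      using assms by (intro mult_left_mono) auto
    moreover have "prox_cost e w x \<le> prox_cost e w z" using prox_minD(2)[OF x z(1)] .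
    ultimately have "F x \<le> (1 - s) * F x + s * F y + e * (s * (lin + s * C))"
      using z(3) by (simp add: prox_cost_def algebra_simps)
    then have "s * F x \<le> s * (F y + e * lin + s * (e * C))" by (simp add: algebra_simps)
    then show ?thesis using s by simp
  qed
  then have "F x \<le> F y + e * lin" by (rule le_of_le_add_small)
  \<comment> \<open>The directional derivative of the divergence at \<open>L x\<close>, rewritten by
    the three-point identity.\<close>
  moreover have "lin = kl_sum m (L y) w - kl_sum m (L x) w - kl_sum m (L y) (L x)"
  proof -
    have "(L y i - L x i) * ln (L x i / w i) = kl (L y i) (w i) - kl (L x i) (w i) - kl (L y i) (L x i)"
      if "i < m" for i
      using kl_three_point[of "L y i" "L x i" "w i"] that w pos L_nonneg[OF y] by simp
    then show ?thesis by (simp add: lin_def kl_sum_def sum_subtractf)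
  qed
  ultimately show ?thesis by (simp add: prox_cost_def algebra_simps)
qed

text \<open>With the second minimizer as competitor, the three-point inequality forces its
  divergence from the first to vanish. This determines \<open>L\<close> only, not the point of
  \<open>K\<close>.\<close>

lemma prox_min_unique:
  assumes "0 < e" and w: "\<And>i. i < m \<Longrightarrow> 0 < w i" and x: "prox_min e w x" "prox_min e w y" and "i < m"
  shows "L x i = L y i"
proof -
  have "prox_cost e w y \<le> prox_cost e w x" using prox_minD[OF x(2)] prox_minD[OF x(1)] by blast
  then have "e * kl_sum m (L y) (L x) \<le> 0"
    using prox_min_three_point[OF assms(1) w x(1) prox_minD(1)[OF x(2)]] by simp
  then have "kl_sum m (L y) (L x) \<le> 0" using assms(1) by (simp add: mult_le_0_iff)
  then show ?thesis
    using kl_sum_eq_zero[of m "L y" "L x" i] assms L_nonneg[OF prox_minD(1)[OF x(2)]]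
      prox_min_pos[OF assms(1) w x(1)] by auto
qed

text \<open>The limit is not known in advance. The minimizer \<open>u\<close> supplies boundedness
  and the limit of the values; a cluster point is then a minimizer too, and the monotone divergence
  from it, being small along a subsequence, tends to 0.\<close>

theorem prox_sequence_convergent:
  assumes e: "\<And>j. 0 < e j" and \<eta>0: "\<And>i. i < m \<Longrightarrow> 0 < \<eta> 0 i"
    and step: "\<And>j. prox_min (e j) (\<eta> j) (X j)" "\<And>j i. i < m \<Longrightarrow> \<eta> (Suc j) i = L (X j) i"
    and diverge: "\<not> summable (\<lambda>j. 1 / e j)"
    and u: "is_arg_min F (\<lambda>x. x \<in> K) u"
  shows "\<exists>x. is_arg_min F (\<lambda>x. x \<in> K) x \<and> (\<forall>i<m. (\<lambda>j. \<eta> j i) \<longlonglongrightarrow> L x i)"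
proof -
  have pos: "0 < \<eta> j i" if "i < m" for i j
  proof (induction j)
    case (Suc j)
    \<comment> \<open>Positivity of one coordinate after a step needs all coordinates before it,
      hence the nested induction over every \<open>k\<close>.\<close>
    have "0 < \<eta> j k" if "k < m" for k
      using prox_min_pos[OF e _ step(1)] that step(2) \<eta>0 
      by (induction j arbitrary: k) (metis)+
    then show ?case using prox_min_pos[OF e _ step(1), of j i] that step(2) by simp
  qed (use \<eta>0 that in simp)
  have XK: "X j \<in> K" for j using prox_minD(1)[OF step(1)] .
  have cong: "kl_sum m v (\<eta> (Suc j)) = kl_sum m v (L (X j))" for v j
    by (simp add: kl_sum_def step(2))
  have fejer: "F (X j) + e j * kl_sum m (L (X j)) (\<eta> j) + e j * kl_sum m (L y) (\<eta> (Suc j))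
      \<le> F y + e j * kl_sum m (L y) (\<eta> j)" if "y \<in> K" for y j
    using prox_min_three_point[OF e pos step(1) that] by (simp add: prox_cost_def cong)
  have nn: "0 \<le> kl_sum m (L y) (\<eta> j)" if "y \<in> K" for y j
    using that pos L_nonneg by (intro kl_sum_nonneg) auto
  have uK: "u \<in> K" and umin: "\<And>y. y \<in> K \<Longrightarrow> F u \<le> F y"
    using u by (auto simp: is_arg_min_linorder)
  \<comment> \<open>Kept general in the minimizer \<open>y\<close>: it is applied to
    \<open>u\<close> and later to the cluster point.\<close>
  have monotone: "kl_sum m (L y) (\<eta> (Suc j)) \<le> kl_sum m (L y) (\<eta> j)"
    if "y \<in> K" "\<And>x. x \<in> K \<Longrightarrow> F y \<le> F x" for y j
  proof -
    have "e j * kl_sum m (L y) (\<eta> (Suc j)) \<le> e j * kl_sum m (L y) (\<eta> j)"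
      using fejer[OF that(1), of j] that(2)[OF XK, of j]
        mult_nonneg_nonneg[OF less_imp_le[OF e] nn[OF XK], of j j j] by linarith
    then show ?thesis using e by simp
  qed
  have F_dec: "decseq (\<lambda>j. F (X j))"
  proof (rule decseq_SucI)
    fix j
    \<comment> \<open>The previous point \<open>X j\<close> competes with divergence 0, because
      \<open>\<eta> (Suc j)\<close> is its own image under \<open>L\<close>.\<close>
    have "F (X (Suc j)) + e (Suc j) * kl_sum m (L (X (Suc j))) (\<eta> (Suc j))
      \<le> F (X j) + e (Suc j) * kl_sum m (L (X j)) (L (X j))"
      using prox_minD(2)[OF step(1) XK, of "Suc j" j] by (simp add: prox_cost_def cong)
    moreover have "kl_sum m (L (X j)) (L (X j)) = 0" by (simp add: kl_sum_def)
    moreover have "0 \<le> e (Suc j) * kl_sum m (L (X (Suc j))) (\<eta> (Suc j))"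
      using nn[OF XK, of "Suc j" "Suc j"] e[of "Suc j"] by simp
    ultimately show "F (X (Suc j)) \<le> F (X j)" by simp
  qed
  define D where "D j = kl_sum m (L u) (\<eta> j)" for j
  \<comment> \<open>Divided by \<open>e j\<close>, the Fejer inequality telescopes in the
    divergences; since the values decrease, each may be replaced by the last one. The divergence of
    the sum of \<open>1 / e j\<close> then closes the gap.\<close>
  have rate: "(F (X J) - F u) * (\<Sum>j\<le>J. 1 / e j) \<le> D 0" for J
  proof -
    have "(F (X J) - F u) * (1 / e j) \<le> D j - D (Suc j)" if "j \<le> J" for j
    proof -
      have "F (X J) \<le> F (X j)" using F_dec that by (simp add: decseq_def)
      moreover have "0 \<le> e j * kl_sum m (L (X j)) (\<eta> j)" using nn XK e by (simp add: less_imp_le)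
      ultimately have "F (X J) - F u \<le> e j * (D j - D (Suc j))"
        using fejer[OF uK, of j] by (simp add: D_def algebra_simps)
      then show ?thesis using e[of j] by (simp add: field_simps)
    qed
    then have "(\<Sum>j\<le>J. (F (X J) - F u) * (1 / e j)) \<le> (\<Sum>j\<le>J. D j - D (Suc j))"
      by (intro sum_mono) auto
    also have "\<dots> = D 0 - D (Suc J)" by (rule sum_telescope)
    also have "\<dots> \<le> D 0" using nn[OF uK] by (simp add: D_def)
    finally show ?thesis by (simp add: sum_distrib_left)
  qed
  have F_lim: "(\<lambda>j. F (X j)) \<longlonglongrightarrow> F u"
  proof (rule LIMSEQ_I)
    fix d :: real assume d: "0 < d"
    have "\<exists>J. F (X J) - F u < d"
    proof (rule ccontr)
      assume "\<nexists>J. F (X J) - F u < d"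
      then have ge: "d \<le> F (X J) - F u" for J by (simp add: not_less)
      have "(\<Sum>j\<le>J. 1 / e j) \<le> D 0 / d" for J
      proof -
        have "0 \<le> (\<Sum>j\<le>J. 1 / e j)" using e by (intro sum_nonneg) (simp add: less_imp_le)
        then have "d * (\<Sum>j\<le>J. 1 / e j) \<le> (F (X J) - F u) * (\<Sum>j\<le>J. 1 / e j)"
          by (intro mult_right_mono ge)
        also have "\<dots> \<le> D 0" by (rule rate)
        finally show ?thesis using d by (simp add: field_simps)
      qed
      then have "summable (\<lambda>j. 1 / e j)"
        using e by (intro bounded_imp_summable[of _ "D 0 / d"])
          (auto simp: less_imp_le)
      then show False using diverge by simp
    qed
    then obtain J where J: "F (X J) - F u < d" by blast
    have "norm (F (X j) - F u) < d" if "J \<le> j" for j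
    proof -
      have "F (X j) \<le> F (X J)" using F_dec that by (simp add: decseq_def)
      then show ?thesis using J umin[OF XK, of j] by simp
    qed
    then show "\<exists>J. \<forall>j\<ge>J. norm (F (X j) - F u) < d" by blast
  qed
  have D_le: "D j \<le> D 0" for j
  proof (induction j)
    case (Suc j)
    then show ?case using monotone[OF uK umin, of j] unfolding D_def by linarith
  qed simp
  define B where "B = (\<Sum>i<m. (sqrt (L u i) + sqrt (D 0))\<^sup>2)"
  have "L (X j) i \<le> B" if i: "i < m" for j i
  proof -
    have "\<bar>sqrt (L u i) - sqrt (\<eta> (Suc j) i)\<bar> \<le> sqrt (D (Suc j))"
      unfolding D_def using i pos L_nonneg uK by (intro kl_sum_sqrt_diff) auto
    also have "\<dots> \<le> sqrt (D 0)" using D_le by simp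
    finally have "sqrt (\<eta> (Suc j) i) \<le> sqrt (L u i) + sqrt (D 0)" by linarith
    then have "\<eta> (Suc j) i \<le> (sqrt (L u i) + sqrt (D 0))\<^sup>2" by (rule sqrt_le_D)
    also have "\<dots> \<le> B" unfolding B_def using i by (intro member_le_sum) auto
    finally show ?thesis using step(2) i by simp
  qed
  then obtain r x where r: "strict_mono r" "x \<in> K" "\<forall>i<m. (\<lambda>k. L (X (r k)) i) \<longlonglongrightarrow> L x i"
    "(\<lambda>k. F (X (r k))) \<longlonglongrightarrow> F x"
    using compact[of X B] XK by blast
  have "F x = F u"
    using LIMSEQ_unique[OF r(4)] LIMSEQ_subseq_LIMSEQ[OF F_lim r(1)] by (simp add: o_def)
  then have xmin: "F x \<le> F y" if "y \<in> K" for y using umin that by simp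
  define E where "E j = kl_sum m (L x) (\<eta> j)" for j
  have E_dec: "decseq E" unfolding E_def using monotone[OF r(2) xmin] by (rule decseq_SucI)
  \<comment> \<open>The successor appears because \<open>\<eta>\<close> is one index ahead of
    \<open>X\<close>.\<close>
  have "(\<lambda>k. E (Suc (r k))) \<longlonglongrightarrow> 0"
    unfolding E_def using r L_nonneg step(2) by (intro tendsto_kl_sum_right) auto
  have E_lim: "E \<longlonglongrightarrow> 0"
  proof (rule LIMSEQ_I)
    fix d :: real assume "0 < d"
    then obtain k where k: "E (Suc (r k)) < d"
      using order_tendstoD(2)[OF \<open>(\<lambda>k. E (Suc (r k))) \<longlonglongrightarrow> 0\<close>, of d]
      by (auto simp: eventually_sequentially)
    have "norm (E j - 0) < d" if "Suc (r k) \<le> j" for j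
      using decseqD[OF E_dec that] k nn[OF r(2), of j] by (simp add: E_def)
    then show "\<exists>N. \<forall>j\<ge>N. norm (E j - 0) < d" by blast
  qed
  have "(\<lambda>j. \<eta> j i) \<longlonglongrightarrow> L x i" if i: "i < m" for i
  proof -
    have lim: "(\<lambda>j. sqrt (E j)) \<longlonglongrightarrow> 0" using tendsto_real_sqrt[OF E_lim] by simp
    have "norm (sqrt (\<eta> j i) - sqrt (L x i)) \<le> norm (sqrt (E j)) * 1" for j
      using kl_sum_sqrt_diff[of m "L x" "\<eta> j" i] i pos L_nonneg[OF r(2)] unfolding E_def
      by (simp add: abs_minus_commute)
    then have "(\<lambda>j. sqrt (\<eta> j i) - sqrt (L x i)) \<longlonglongrightarrow> 0"
      by (intro tendsto_0_le[OF lim always_eventually]) blast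
    then have "(\<lambda>j. sqrt (\<eta> j i)) \<longlonglongrightarrow> sqrt (L x i)" by (simp add: LIM_zero_iff)
    then have "(\<lambda>j. (sqrt (\<eta> j i))\<^sup>2) \<longlonglongrightarrow> (sqrt (L x i))\<^sup>2" by (rule tendsto_power)
    then show ?thesis using pos[OF i] L_nonneg[OF r(2) i] by (simp add: less_imp_le)
  qed
  then show ?thesis using r(2) xmin by (auto simp: is_arg_min_linorder)
qed

end

section \<open>The flow problem\<close>

text \<open>The logarithm splits into \<open>ln (x j / (r * a j)) + ln (r / v)\<close>, and the
  total 1 of \<open>a\<close> collects the linear terms into those of \<open>kl r v\<close>. For a
  row without mass both sides equal \<open>v\<close>.\<close>

lemma kl_chain:
  fixes n :: nat
  assumes "\<And>j. j < n \<Longrightarrow> 0 \<le> x j" "\<And>j. j < n \<Longrightarrow> 0 \<le> a j" "\<And>j. j < n \<Longrightarrow> x j \<noteq> 0 \<Longrightarrow> a j \<noteq> 0"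
    and a: "(\<Sum>j<n. a j) = 1" and r: "r = (\<Sum>j<n. x j)" and v: "r \<noteq> 0 \<Longrightarrow> 0 < v"
  shows "(\<Sum>j<n. kl (x j) (v * a j)) = (\<Sum>j<n. kl (x j) (r * a j)) + kl r v"
proof (cases "r = 0")
  case True
  then have "x j = 0" if "j < n" for j
    using that assms(1) r True sum_nonneg_0[of "{..<n}" x j] by simp
  then show ?thesis using True a by (simp flip: sum_distrib_left)
next
  case False
  then have r0: "0 < r" "0 < v" using v r assms(1) by (auto simp: less_le intro!: sum_nonneg)
  have "kl (x j) (v * a j) = kl (x j) (r * a j) + (x j * ln (r / v) - r * a j + v * a j)" if "j < n" for j
  proof (cases "x j = 0")
    case False
    then have "0 < x j" "0 < a j" using assms(1-3)[OF that] by auto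
    then show ?thesis using r0 by (simp add: kl_def ln_div ln_mult algebra_simps)
  qed simp
  then have "(\<Sum>j<n. kl (x j) (v * a j))
      = (\<Sum>j<n. kl (x j) (r * a j)) + ((\<Sum>j<n. x j) * ln (r / v) - r * (\<Sum>j<n. a j) + v * (\<Sum>j<n. a j))"
    by (simp add: sum.distrib sum_subtractf sum_distrib_left sum_distrib_right)
  then show ?thesis using a r by (simp add: kl_def)
qed

section \<open>Coordinate form of the matrix constraints\<close>

lemma mult_ones_vec:
  assumes "B \<in> carrier_mat n n"
  shows "B *\<^sub>v ones_vec n = vec n (\<lambda>i. \<Sum>j<n. B $$ (i, j))"
  using assms by (auto simp: ones_vec_def scalar_prod_def lessThan_atLeast0)

lemma transpose_mult_ones_vec:
  assumes "B \<in> carrier_mat n n"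
  shows "transpose_mat B *\<^sub>v ones_vec n = vec n (\<lambda>j. \<Sum>i<n. B $$ (i, j))"
  using assms by (auto simp: ones_vec_def scalar_prod_def lessThan_atLeast0)

lemma selection_mat_index:
  assumes "a < length is" "j < n"
  shows "selection_mat n is $$ (a, j) = (if is ! a = j then 1 else 0)"
  using assms by (auto simp: selection_mat_def mat_of_rows_index unit_vec_def)

lemma selection_mat_carrier: "selection_mat n is \<in> carrier_mat (length is) n"
  by (metis length_map mat_of_rows_carrier(1) selection_mat_def)

lemma selection_mat_mult_vec:
  assumes "set is \<subseteq> {..<n}"
  shows "selection_mat n is *\<^sub>v vec n g = vec (length is) (\<lambda>a. g (is ! a))"
proof (rule eq_vecI)
  fix a assume "a < dim_vec (vec (length is) (\<lambda>a. g (is ! a)))"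
  then have a: "a < length is" by simp
  then have "is ! a < n" using assms nth_mem by fastforce
  then show "(selection_mat n is *\<^sub>v vec n g) $ a = vec (length is) (\<lambda>a. g (is ! a)) $ a"
    using a selection_mat_carrier[of n "is"]
    by (simp add: scalar_prod_def selection_mat_index if_distrib[of "\<lambda>x. x * _"] cong: if_cong)
qed (use selection_mat_carrier[of n "is"] in simp)

lemma transpose_selection_mat_mult_vec:
  assumes "w \<in> carrier_vec (length is)"
  shows "transpose_mat (selection_mat n is) *\<^sub>v w
    = vec n (\<lambda>i. \<Sum>a<length is. if is ! a = i then w $ a else 0)"
proof (rule eq_vecI)
  fix i assume "i < dim_vec (vec n (\<lambda>i. \<Sum>a<length is. if is ! a = i then w $ a else 0))"
  then have i: "i < n" by simp
  show "(transpose_mat (selection_mat n is) *\<^sub>v w) $ i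
      = vec n (\<lambda>i. \<Sum>a<length is. if is ! a = i then w $ a else 0) $ i"
    using i selection_mat_carrier[of n "is"] assms
    by (auto simp: scalar_prod_def selection_mat_index lessThan_atLeast0 intro!: sum.cong)
qed (use selection_mat_carrier[of n "is"] in simp)

definition row_mass :: "nat \<Rightarrow> real mat \<Rightarrow> nat \<Rightarrow> real" where
  "row_mass n B i = (\<Sum>j<n. B $$ (i, j))"

definition col_mass :: "nat \<Rightarrow> real mat \<Rightarrow> nat \<Rightarrow> real" where
  "col_mass n B j = (\<Sum>i<n. B $$ (i, j))"

text \<open>Real-valued: an infinite divergence is recorded instead as failure of the support
  condition of (P). Indexing by triples makes the objective a single finite sum.\<close>

definition edge_cost :: "nat \<Rightarrow> (nat \<Rightarrow> real mat) \<Rightarrow> (nat \<Rightarrow> real mat) \<Rightarrow> nat \<times> nat \<times> nat \<Rightarrow> real" where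
  "edge_cost n A M = (\<lambda>(t, i, j). kl (M t $$ (i, j)) (row_mass n (M t) i * A t $$ (i, j)))"

lemma flow_constraints_iff:
  assumes "T \<ge> 1" "set ps \<subseteq> {..<n}" "\<forall>t\<le>T. \<rho> t \<in> carrier_vec (length ps)"
  shows "flow_constraints n T ps \<rho> M \<longleftrightarrow>
    (\<forall>t<T. M t \<in> carrier_mat n n \<and> (\<forall>i<n. \<forall>j<n. 0 \<le> M t $$ (i, j))) \<and>
    (\<forall>t<T. \<forall>a<length ps. row_mass n (M t) (ps ! a) = \<rho> t $ a) \<and>
    (\<forall>a<length ps. col_mass n (M (T - 1)) (ps ! a) = \<rho> T $ a) \<and>
    (\<forall>t. 1 \<le> t \<and> t < T \<longrightarrow> (\<forall>i<n. row_mass n (M t) i = col_mass n (M (t - 1)) i))"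
proof (cases "\<forall>t<T. M t \<in> carrier_mat n n")
  case True
  have row: "M t *\<^sub>v ones_vec n = vec n (row_mass n (M t))"
    and col: "transpose_mat (M t) *\<^sub>v ones_vec n = vec n (col_mass n (M t))" if "t < T" for t
    using True that mult_ones_vec[of "M t" n] transpose_mult_ones_vec[of "M t" n]
    by (simp_all only: row_mass_def[abs_def] col_mass_def[abs_def])
  have nonneg: "0\<^sub>m n n \<le> M t \<longleftrightarrow> (\<forall>i<n. \<forall>j<n. 0 \<le> M t $$ (i, j))" if "t < T" for t
    using True that by (auto simp: less_eq_mat_def)
  have sel: "vec (length ps) g = \<rho> t \<longleftrightarrow> (\<forall>a<length ps. g a = \<rho> t $ a)" if "t \<le> T" for g t
    
  proof -
    have "dim_vec (\<rho> t) = length ps" using assms(3) that by (meson carrier_vecD)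
    then show ?thesis unfolding vec_eq_iff by simp
  qed
  have 1: "(\<forall>t<T. M t \<in> carrier_mat n n \<and> 0\<^sub>m n n \<le> M t) \<longleftrightarrow>
      (\<forall>t<T. M t \<in> carrier_mat n n \<and> (\<forall>i<n. \<forall>j<n. 0 \<le> M t $$ (i, j)))"
    using nonneg by blast
  have "obs_mat n ps *\<^sub>v (M t *\<^sub>v ones_vec n) = \<rho> t \<longleftrightarrow>
      (\<forall>a<length ps. row_mass n (M t) (ps ! a) = \<rho> t $ a)" if "t < T" for t
    using that by (simp only: obs_mat_def row selection_mat_mult_vec[OF assms(2)] sel[OF less_imp_le])
  then have 2: "(\<forall>t<T. obs_mat n ps *\<^sub>v (M t *\<^sub>v ones_vec n) = \<rho> t) \<longleftrightarrow>
      (\<forall>t<T. \<forall>a<length ps. row_mass n (M t) (ps ! a) = \<rho> t $ a)"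
    by blast
  have "T - 1 < T" using assms(1) by simp
  then have 3: "obs_mat n ps *\<^sub>v (transpose_mat (M (T - 1)) *\<^sub>v ones_vec n) = \<rho> T \<longleftrightarrow>
      (\<forall>a<length ps. col_mass n (M (T - 1)) (ps ! a) = \<rho> T $ a)"
    by (simp only: obs_mat_def col selection_mat_mult_vec[OF assms(2)] sel[OF order_refl])
  have "M t *\<^sub>v ones_vec n = transpose_mat (M (t - 1)) *\<^sub>v ones_vec n \<longleftrightarrow>
      (\<forall>i<n. row_mass n (M t) i = col_mass n (M (t - 1)) i)" if "1 \<le> t" "t < T" for t
  proof -
    have "t - 1 < T" using that by simp
    then show ?thesis unfolding row[OF that(2)] col[OF \<open>t - 1 < T\<close>] vec_eq_iff by simp
  qed
  then have 4: "(\<forall>t. 1 \<le> t \<and> t < T \<longrightarrow>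
        M t *\<^sub>v ones_vec n = transpose_mat (M (t - 1)) *\<^sub>v ones_vec n) \<longleftrightarrow>
      (\<forall>t. 1 \<le> t \<and> t < T \<longrightarrow> (\<forall>i<n. row_mass n (M t) i = col_mass n (M (t - 1)) i))"
    by blast
  show ?thesis unfolding flow_constraints_def 1 2 3 4 ..
qed (auto simp: flow_constraints_def)

section \<open>Feasible flows and elementary estimates\<close>

locale flow_problem =
  fixes n T :: nat and ps :: "nat list" and A :: "nat \<Rightarrow> real mat" and \<rho> :: "nat \<Rightarrow> real vec"
    and M0 :: "nat \<Rightarrow> real mat"
  assumes T: "T \<ge> 1"
    and stochastic: "t < T \<Longrightarrow> row_stochastic n (A t)"
    and distinct_ps: "distinct ps" and set_ps: "set ps \<subseteq> {..<n}"
    and \<rho>_carrier: "\<forall>t\<le>T. \<rho> t \<in> carrier_vec (length ps)"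
    and M0: "feasible_P n T ps A \<rho> M0"
    and M0_pos: "t < T \<Longrightarrow> i < n \<Longrightarrow> j < n \<Longrightarrow> A t $$ (i, j) > 0 \<Longrightarrow> M0 t $$ (i, j) > 0"
begin

definition hs :: "nat list" where "hs = filter (\<lambda>i. i \<notin> set ps) [0..<n]"

definition m :: nat where "m = n - length ps"

definition K :: "(nat \<Rightarrow> real mat) set" where "K = {M. feasible_P n T ps A \<rho> M}"

definition edges :: "(nat \<times> nat \<times> nat) set" where "edges = {..<T} \<times> {..<n} \<times> {..<n}"

definition F :: "(nat \<Rightarrow> real mat) \<Rightarrow> real" where "F M = sum (edge_cost n A M) edges"

definition L :: "(nat \<Rightarrow> real mat) \<Rightarrow> nat \<Rightarrow> real" where "L M a = row_mass n (M 0) (hs ! a)"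

lemma set_hs: "set hs = {..<n} - set ps" by (auto simp: hs_def)

lemma length_hs: "length hs = m"
proof -
  have "distinct hs" by (simp add: hs_def)
  then have "length hs = card (set hs)" by (simp only: distinct_card)
  also have "\<dots> = n - card (set ps)" using set_ps by (simp add: set_hs card_Diff_subset)
  finally show ?thesis by (simp add: m_def distinct_card[OF distinct_ps])
qed

lemma hs_less: "a < m \<Longrightarrow> hs ! a < n"
  using set_hs length_hs by (metis DiffD1 lessThan_iff nth_mem)

lemma ps_less: "a < length ps \<Longrightarrow> ps ! a < n"
  using set_ps by (meson lessThan_iff nth_mem subsetD)

lemma sum_split: "(\<Sum>i<n. g i) = (\<Sum>a<length ps. g (ps ! a)) + (\<Sum>a<m. (g (hs ! a) :: real))"
proof -
  have list: "sum g (set xs) = (\<Sum>a<length xs. g (xs ! a))" if "distinct xs" for xs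
    using sum.reindex_bij_betw[OF bij_betw_nth[OF that refl refl], of g] by simp
  have "{..<n} = set ps \<union> set hs" using set_ps by (auto simp: set_hs)
  then have "(\<Sum>i<n. g i) = sum g (set ps) + sum g (set hs)"
    by (simp only: sum.union_disjoint) (subst sum.union_disjoint, auto simp: set_hs)
  then show ?thesis using list[OF distinct_ps] list[of hs] by (simp add: length_hs) (simp add: hs_def)
qed

lemma A_nonneg: "t < T \<Longrightarrow> i < n \<Longrightarrow> j < n \<Longrightarrow> 0 \<le> A t $$ (i, j)"
  using stochastic[of t] unfolding row_stochastic_def less_eq_mat_def by (metis carrier_matD index_zero_mat(1))

lemma A_carrier: "t < T \<Longrightarrow> A t \<in> carrier_mat n n"
  using stochastic[of t] by (simp add: row_stochastic_def)

lemma A_row_sum: "t < T \<Longrightarrow> i < n \<Longrightarrow> (\<Sum>j<n. A t $$ (i, j)) = 1"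
  using stochastic[of t] mult_ones_vec[of "A t" n] unfolding row_stochastic_def ones_vec_def
  by (metis index_vec)

lemmas constraints_iff = flow_constraints_iff[OF T set_ps \<rho>_carrier]

lemma flowD:
  assumes "flow_constraints n T ps \<rho> M"
  shows "t < T \<Longrightarrow> M t \<in> carrier_mat n n"
    and "t < T \<Longrightarrow> i < n \<Longrightarrow> j < n \<Longrightarrow> 0 \<le> M t $$ (i, j)"
    and "t < T \<Longrightarrow> a < length ps \<Longrightarrow> row_mass n (M t) (ps ! a) = \<rho> t $ a"
    and "a < length ps \<Longrightarrow> col_mass n (M (T - 1)) (ps ! a) = \<rho> T $ a"
    and "Suc t < T \<Longrightarrow> i < n \<Longrightarrow> row_mass n (M (Suc t)) i = col_mass n (M t) i"
  using assms unfolding constraints_iff by (auto dest!: spec[of _ "Suc t"])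

lemma K_D:
  assumes "M \<in> K"
  shows "flow_constraints n T ps \<rho> M"
    and "t < T \<Longrightarrow> i < n \<Longrightarrow> j < n \<Longrightarrow> M t $$ (i, j) \<noteq> 0 \<Longrightarrow> A t $$ (i, j) \<noteq> 0"
  using assms by (auto simp: K_def feasible_P_def)

lemma K_I:
  assumes "\<And>t. t < T \<Longrightarrow> M t \<in> carrier_mat n n"
    and "\<And>t i j. t < T \<Longrightarrow> i < n \<Longrightarrow> j < n \<Longrightarrow> 0 \<le> M t $$ (i, j)"
    and "\<And>t a. t < T \<Longrightarrow> a < length ps \<Longrightarrow> row_mass n (M t) (ps ! a) = \<rho> t $ a"
    and "\<And>a. a < length ps \<Longrightarrow> col_mass n (M (T - 1)) (ps ! a) = \<rho> T $ a"
    and "\<And>t i. Suc t < T \<Longrightarrow> i < n \<Longrightarrow> row_mass n (M (Suc t)) i = col_mass n (M t) i"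
    and "\<And>t i j. t < T \<Longrightarrow> i < n \<Longrightarrow> j < n \<Longrightarrow> M t $$ (i, j) \<noteq> 0 \<Longrightarrow> A t $$ (i, j) \<noteq> 0"
  shows "M \<in> K"
proof -
  have "row_mass n (M t) i = col_mass n (M (t - 1)) i" if "1 \<le> t" "t < T" "i < n" for t i
    using assms(5)[of "t - 1" i] that by simp
  then show ?thesis using assms unfolding K_def feasible_P_def constraints_iff by auto
qed

lemma row_mass_nonneg:
  assumes "flow_constraints n T ps \<rho> M" "t < T" "i < n"
  shows "0 \<le> row_mass n (M t) i"
  unfolding row_mass_def using flowD(2)[OF assms(1)] assms by (intro sum_nonneg) auto

lemma entry_le_row_mass:
  assumes "flow_constraints n T ps \<rho> M" "t < T" "i < n" "j < n"
  shows "M t $$ (i, j) \<le> row_mass n (M t) i"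
  unfolding row_mass_def using flowD(2)[OF assms(1)] assms
  by (intro member_le_sum[of j "{..<n}" "\<lambda>j. M t $$ (i, j)"]) auto

lemma entry_le_col_mass:
  assumes "flow_constraints n T ps \<rho> M" "t < T" "i < n" "j < n"
  shows "M t $$ (i, j) \<le> col_mass n (M t) j"
  unfolding col_mass_def using flowD(2)[OF assms(1)] assms
  by (intro member_le_sum[of i "{..<n}" "\<lambda>i. M t $$ (i, j)"]) auto

lemma row_mass_pos:
  assumes "flow_constraints n T ps \<rho> M" "t < T" "i < n" "j < n" "M t $$ (i, j) \<noteq> 0"
  shows "0 < row_mass n (M t) i"
  using entry_le_row_mass[OF assms(1-4)] flowD(2)[OF assms(1-4)] assms(5) by linarith

lemma edge_cost_pre:
  assumes "M \<in> K" "t < T" "i < n" "j < n"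
  shows "0 \<le> M t $$ (i, j)" "0 \<le> row_mass n (M t) i * A t $$ (i, j)"
    "M t $$ (i, j) \<noteq> 0 \<longrightarrow> row_mass n (M t) i * A t $$ (i, j) \<noteq> 0"
  using assms K_D flowD(2)[OF K_D(1)] row_mass_nonneg[OF K_D(1)] A_nonneg row_mass_pos[OF K_D(1)]
  by fastforce+

lemma edge_cost_nonneg:
  assumes "M \<in> K" "e \<in> edges"
  shows "0 \<le> edge_cost n A M e"
proof -
  obtain t i j where [simp]: "e = (t, i, j)" and t: "t < T" "i < n" "j < n"
    using assms(2) by (auto simp: edges_def)
  show ?thesis using kl_nonneg[OF edge_cost_pre[OF assms(1) t]] by (simp add: edge_cost_def)
qed

lemma edge_cost_le_F: "M \<in> K \<Longrightarrow> e \<in> edges \<Longrightarrow> edge_cost n A M e \<le> F M"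
  unfolding F_def by (intro member_le_sum edge_cost_nonneg) (auto simp: edges_def)

section \<open>Convexity and compactness of the feasible flows\<close>

definition mix :: "real \<Rightarrow> (nat \<Rightarrow> real mat) \<Rightarrow> (nat \<Rightarrow> real mat) \<Rightarrow> nat \<Rightarrow> real mat" where
  "mix s M N t = mat n n (\<lambda>(i, j). (1 - s) * M t $$ (i, j) + s * N t $$ (i, j))"

lemma row_mass_mix: "i < n \<Longrightarrow> row_mass n (mix s M N t) i = (1 - s) * row_mass n (M t) i + s * row_mass n (N t) i"
  by (simp add: row_mass_def mix_def sum.distrib sum_distrib_left)

lemma col_mass_mix: "i < n \<Longrightarrow> col_mass n (mix s M N t) i = (1 - s) * col_mass n (M t) i + s * col_mass n (N t) i"
  by (simp add: col_mass_def mix_def sum.distrib sum_distrib_left)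

lemma mix_in_K:
  assumes M: "M \<in> K" and N: "N \<in> K" and s: "0 \<le> s" "s \<le> 1"
  shows "mix s M N \<in> K"
proof (rule K_I)
  fix t i j assume t: "t < T" "i < n" "j < n"
  show "0 \<le> mix s M N t $$ (i, j)"
    using flowD(2)[OF K_D(1)[OF M] t] flowD(2)[OF K_D(1)[OF N] t] s t by (simp add: mix_def)
  show "A t $$ (i, j) \<noteq> 0" if "mix s M N t $$ (i, j) \<noteq> 0"
  proof -
    have "M t $$ (i, j) \<noteq> 0 \<or> N t $$ (i, j) \<noteq> 0" using that t by (auto simp: mix_def)
    then show ?thesis using K_D(2)[OF M t] K_D(2)[OF N t] by blast
  qed
next
  fix a assume a: "a < length ps"
  show "col_mass n (mix s M N (T - 1)) (ps ! a) = \<rho> T $ a"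
    using flowD(4)[OF K_D(1)[OF M] a] flowD(4)[OF K_D(1)[OF N] a] a
    by (simp add: col_mass_mix ps_less algebra_simps)
  fix t assume t: "t < T"
  show "row_mass n (mix s M N t) (ps ! a) = \<rho> t $ a"
    using flowD(3)[OF K_D(1)[OF M] t a] flowD(3)[OF K_D(1)[OF N] t a] a
    by (simp add: row_mass_mix ps_less algebra_simps)
next
  fix t i assume t: "Suc t < T" "i < n"
  show "row_mass n (mix s M N (Suc t)) i = col_mass n (mix s M N t) i"
    using flowD(5)[OF K_D(1)[OF M] t] flowD(5)[OF K_D(1)[OF N] t] t
    by (simp add: row_mass_mix col_mass_mix)
qed (simp add: mix_def)

text \<open>The reference mass moves linearly with the flow, so convexity of \<open>kl\<close> in
  both arguments jointly is what is required.\<close>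

lemma edge_cost_mix:
  assumes M: "M \<in> K" and N: "N \<in> K" and s: "0 \<le> s" "s \<le> 1" and e: "e \<in> edges"
  shows "edge_cost n A (mix s M N) e \<le> (1 - s) * edge_cost n A M e + s * edge_cost n A N e"
proof -
  obtain t i j where [simp]: "e = (t, i, j)" and t: "t < T" "i < n" "j < n"
    using e by (auto simp: edges_def)
  have "((1 - s) * row_mass n (M t) i + s * row_mass n (N t) i) * A t $$ (i, j)
    = (1 - s) * (row_mass n (M t) i * A t $$ (i, j)) + s * (row_mass n (N t) i * A t $$ (i, j))"
    by (simp add: algebra_simps)
  moreover have "mix s M N t $$ (i, j) = (1 - s) * M t $$ (i, j) + s * N t $$ (i, j)"
    using t by (simp add: mix_def)
  ultimately show ?thesis
    using kl_convex[OF edge_cost_pre[OF M t] edge_cost_pre[OF N t] s] t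
    by (simp add: edge_cost_def row_mass_mix)
qed

lemma F_mix:
  assumes "M \<in> K" "N \<in> K" "0 \<le> s" "s \<le> 1"
  shows "F (mix s M N) \<le> (1 - s) * F M + s * F N"
  unfolding F_def sum_distrib_left sum.distrib[symmetric]
  using edge_cost_mix assms by (intro sum_mono) auto

lemma total_mass:
  assumes M: "flow_constraints n T ps \<rho> M"
  shows "t < T \<Longrightarrow> (\<Sum>i<n. row_mass n (M t) i) = (\<Sum>i<n. row_mass n (M 0) i)"
proof (induction t)
  case (Suc t)
  have "(\<Sum>i<n. row_mass n (M (Suc t)) i) = (\<Sum>i<n. col_mass n (M t) i)"
    using flowD(5)[OF M Suc.prems] by simp
  also have "\<dots> = (\<Sum>i<n. row_mass n (M t) i)"
    unfolding row_mass_def col_mass_def by (rule sum.swap)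
  finally show ?case using Suc by simp
qed simp

text \<open>Mass is conserved in time and the observed initial mass is prescribed, so the hidden
  initial masses control every entry.\<close>

lemma entry_bounded:
  fixes B :: real
  assumes M: "M \<in> K" and B: "\<And>a. a < m \<Longrightarrow> L M a \<le> B" and t: "t < T" "i < n" "j < n"
  shows "\<bar>M t $$ (i, j)\<bar> \<le> (\<Sum>a<length ps. \<rho> 0 $ a) + m * B"
proof -
  note flow = K_D(1)[OF M]
  have "\<bar>M t $$ (i, j)\<bar> \<le> row_mass n (M t) i"
    using entry_le_row_mass[OF flow t] flowD(2)[OF flow t] by simp
  also have "\<dots> \<le> (\<Sum>i<n. row_mass n (M t) i)"
    using row_mass_nonneg[OF flow t(1)] t by (intro member_le_sum) auto
  also have "\<dots> = (\<Sum>i<n. row_mass n (M 0) i)" using total_mass[OF flow t(1)] .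
  also have "\<dots> = (\<Sum>a<length ps. \<rho> 0 $ a) + (\<Sum>a<m. L M a)"
    using flowD(3)[OF flow, of 0] T by (simp add: sum_split L_def)
  also have "(\<Sum>a<m. L M a) \<le> (\<Sum>a<m. B)" using B by (intro sum_mono) auto
  finally show ?thesis by simp
qed

text \<open>The support condition survives the limit because an edge excluded by \<open>A\<close> is
  empty along the whole sequence. On every edge the entry is dominated by its row mass, which makes
  the costs converge.\<close>

lemma K_compact:
  fixes X :: "nat \<Rightarrow> nat \<Rightarrow> real mat" and B :: real
  assumes X: "\<And>k. X k \<in> K" and B: "\<And>k a. a < m \<Longrightarrow> L (X k) a \<le> B"
  shows "\<exists>r Y. strict_mono r \<and> Y \<in> K \<and> (\<forall>a<m. (\<lambda>k. L (X (r k)) a) \<longlonglongrightarrow> L Y a) \<and>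
    (\<lambda>k. F (X (r k))) \<longlonglongrightarrow> F Y"
proof -
  have "\<exists>r l. strict_mono r \<and> (\<forall>e\<in>edges. (\<lambda>k. (\<lambda>(t, i, j). X (r k) t $$ (i, j)) e) \<longlonglongrightarrow> l e)"
    using entry_bounded[OF X B]
    by (intro convergent_subseq_finite[where B = "(\<Sum>a<length ps. \<rho> 0 $ a) + m * B"])
      (auto simp: edges_def)
  then obtain r l where r: "strict_mono r"
    "\<forall>e\<in>edges. (\<lambda>k. (\<lambda>(t, i, j). X (r k) t $$ (i, j)) e) \<longlonglongrightarrow> l e" by blast
  define Y where "Y t = mat n n (\<lambda>(i, j). l (t, i, j))" for t
  have lim: "(\<lambda>k. X (r k) t $$ (i, j)) \<longlonglongrightarrow> Y t $$ (i, j)" if "t < T" "i < n" "j < n" for t i j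
    using r(2) that by (auto simp: Y_def edges_def)
  have row: "(\<lambda>k. row_mass n (X (r k) t) i) \<longlonglongrightarrow> row_mass n (Y t) i" if "t < T" "i < n" for t i
    unfolding row_mass_def using lim that by (intro tendsto_sum) auto
  have col: "(\<lambda>k. col_mass n (X (r k) t) i) \<longlonglongrightarrow> col_mass n (Y t) i" if "t < T" "i < n" for t i
    unfolding col_mass_def using lim that by (intro tendsto_sum) auto
  note flow = K_D(1)[OF X]
  have "Y \<in> K"
  proof (rule K_I)
    fix t i j assume t: "t < T" "i < n" "j < n"
    show "0 \<le> Y t $$ (i, j)"
      using lim[OF t] flowD(2)[OF flow t] by (intro LIMSEQ_le_const) auto
    show "A t $$ (i, j) \<noteq> 0" if nz: "Y t $$ (i, j) \<noteq> 0"
    proof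
      assume "A t $$ (i, j) = 0"
      then have "X (r k) t $$ (i, j) = 0" for k using K_D(2)[OF X t] by blast
      then show False using lim[OF t] nz by (simp add: LIMSEQ_const_iff)
    qed
  next
    fix a assume a: "a < length ps"
    show "col_mass n (Y (T - 1)) (ps ! a) = \<rho> T $ a"
      using col[of "T - 1" "ps ! a"] T flowD(4)[OF flow a] ps_less[OF a]
      by (simp add: LIMSEQ_const_iff)
    fix t assume t: "t < T"
    show "row_mass n (Y t) (ps ! a) = \<rho> t $ a"
      using row[of t "ps ! a"] t flowD(3)[OF flow t a] ps_less[OF a]
      by (simp add: LIMSEQ_const_iff)
  next
    fix t i assume t: "Suc t < T" "i < n"
    show "row_mass n (Y (Suc t)) i = col_mass n (Y t) i"
      using row[OF t] col[of t i] t flowD(5)[OF flow t] by (simp add: LIMSEQ_unique)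
  qed (simp add: Y_def)
  moreover have "(\<lambda>k. F (X (r k))) \<longlonglongrightarrow> F Y"
  proof -
    have "(\<lambda>k. edge_cost n A (X (r k)) e) \<longlonglongrightarrow> edge_cost n A Y e" if e: "e \<in> edges" for e
    proof -
      obtain t i j where [simp]: "e = (t, i, j)" and t: "t < T" "i < n" "j < n"
        using e by (auto simp: edges_def)
      have "(\<lambda>k. kl (X (r k) t $$ (i, j)) (row_mass n (X (r k) t) i * A t $$ (i, j)))
        \<longlonglongrightarrow> kl (Y t $$ (i, j)) (row_mass n (Y t) i * A t $$ (i, j))"
        using flowD(2)[OF flow t] entry_le_row_mass[OF flow t] lim[OF t] row[OF t(1,2)]
          A_nonneg[OF t] K_D(2)[OF X t]
        by (rule tendsto_kl_scaled)
      then show ?thesis by (simp add: edge_cost_def)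
    qed
    then show ?thesis unfolding F_def by (intro tendsto_sum)
  qed
  moreover have "(\<lambda>k. L (X (r k)) a) \<longlonglongrightarrow> L Y a" if "a < m" for a
    unfolding L_def using row hs_less that T by simp
  ultimately show ?thesis using r(1) by blast
qed

lemma L_M0_pos:
  assumes "a < m"
  shows "0 < L M0 a"
proof -
  have i: "hs ! a < n" "0 < T" using hs_less[OF assms] T by auto
  have "\<exists>j<n. A 0 $$ (hs ! a, j) \<noteq> 0"
    using A_row_sum[OF i(2,1)] by (metis lessThan_iff sum.neutral zero_neq_one)
  then obtain j where j: "j < n" "0 < A 0 $$ (hs ! a, j)"
    using A_nonneg[OF i(2,1)] by (metis less_le)
  then have "0 < M0 0 $$ (hs ! a, j)" using M0_pos i by blast
  moreover have "flow_constraints n T ps \<rho> M0" using M0 by (simp add: feasible_P_def)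
  ultimately show ?thesis using row_mass_pos[of M0 0 "hs ! a" j] i j by (simp add: L_def)
qed

sublocale prox_problem K F L m M0
proof
  fix x i assume "x \<in> K" "i < m"
  then show "0 \<le> L x i" using row_mass_nonneg[OF K_D(1)] hs_less T by (simp add: L_def)
next
  fix x y and s :: real assume *: "x \<in> K" "y \<in> K" "0 \<le> s" "s \<le> 1"
  show "\<exists>z\<in>K. (\<forall>i<m. L z i = (1 - s) * L x i + s * L y i) \<and> F z \<le> (1 - s) * F x + s * F y"
    using mix_in_K[OF *] F_mix[OF *] hs_less row_mass_mix by (auto simp: L_def intro!: bexI[of _ "mix s x y"])
next
  show "0 \<le> F x" if "x \<in> K" for x unfolding F_def using that by (intro sum_nonneg edge_cost_nonneg)
  show "M0 \<in> K" using M0 by (simp add: K_def)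
qed (fact L_M0_pos K_compact)+

lemma prox_min_unique_flow:
  assumes "0 < e" and w: "\<And>i. i < m \<Longrightarrow> 0 < w i" and M: "prox_min e w M" and N: "prox_min e w N"
    and "t < T"
  shows "M t = N t"
proof (rule ccontr)
  assume "M t \<noteq> N t"
  define t0 where "t0 = (LEAST t. t < T \<and> M t \<noteq> N t)"
  have t0: "t0 < T" "M t0 \<noteq> N t0"
    using LeastI[of "\<lambda>t. t < T \<and> M t \<noteq> N t" t] assms(5) \<open>M t \<noteq> N t\<close> by (auto simp: t0_def)
  have before: "M t = N t" if "t < t0" for t
    using not_less_Least[of t "\<lambda>t. t < T \<and> M t \<noteq> N t"] that t0(1) by (auto simp: t0_def)
  have MK: "M \<in> K" and NK: "N \<in> K" using prox_minD(1) M N by auto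
  note fM = K_D(1)[OF MK] and fN = K_D(1)[OF NK]
  have L_eq: "L M a = L N a" if "a < m" for a using prox_min_unique[OF assms(1) w M N that] .
  have row: "row_mass n (M t0) i = row_mass n (N t0) i" if i: "i < n" for i
  proof (cases t0)
    case 0
    have "i \<in> set ps \<or> i \<in> set hs" using i by (auto simp: set_hs)
    then show ?thesis
    proof
      assume "i \<in> set ps"
      then obtain a where "a < length ps" "i = ps ! a" by (metis in_set_conv_nth)
      then show ?thesis using flowD(3)[OF fM t0(1)] flowD(3)[OF fN t0(1)] by simp
    next
      assume "i \<in> set hs"
      then obtain a where "a < m" "i = hs ! a" by (metis in_set_conv_nth length_hs)
      then show ?thesis using L_eq 0 by (simp add: L_def)
    qed
  next
    case (Suc t)
    then show ?thesis
      using flowD(5)[OF fM, of t i] flowD(5)[OF fN, of t i] before[of t] t0 i by simp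
  qed
  obtain i j where ij: "i < n" "j < n" "M t0 $$ (i, j) \<noteq> N t0 $$ (i, j)"
    using t0(2) flowD(1)[OF fM t0(1)] flowD(1)[OF fN t0(1)] by (metis carrier_matD eq_matI)
  define Z where "Z = mix (1 / 2) M N"
  have ZK: "Z \<in> K" unfolding Z_def by (intro mix_in_K MK NK) auto
  let ?y = "row_mass n (M t0) i * A t0 $$ (i, j)"
  have "?y \<noteq> 0"
    using edge_cost_pre(3)[OF MK t0(1) ij(1,2)] edge_cost_pre(3)[OF NK t0(1) ij(1,2)] ij(3) row[OF ij(1)]
    by auto
  then have y: "0 < ?y" using edge_cost_pre(2)[OF MK t0(1) ij(1,2)] by linarith
  have "F Z < (\<Sum>e\<in>edges. (1 - 1 / 2) * edge_cost n A M e + 1 / 2 * edge_cost n A N e)"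
    unfolding F_def
  proof (rule sum_strict_mono_ex1)
    show "\<forall>e\<in>edges. edge_cost n A Z e \<le> (1 - 1 / 2) * edge_cost n A M e + 1 / 2 * edge_cost n A N e"
      unfolding Z_def by (intro ballI edge_cost_mix MK NK) auto
    have strict: "kl ((M t0 $$ (i, j) + N t0 $$ (i, j)) / 2) ?y < (kl (M t0 $$ (i, j)) ?y + kl (N t0 $$ (i, j)) ?y) / 2"
      using kl_midpoint_less[OF edge_cost_pre(1)[OF MK t0(1) ij(1,2)] edge_cost_pre(1)[OF NK t0(1) ij(1,2)] y ij(3)] .
    have Z_entry: "Z t0 $$ (i, j) = (M t0 $$ (i, j) + N t0 $$ (i, j)) / 2"
      using ij by (simp add: Z_def mix_def)
    have Z_row: "row_mass n (Z t0) i = row_mass n (M t0) i"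
      using row[OF ij(1)] ij by (simp add: Z_def row_mass_mix)
    have "edge_cost n A Z (t0, i, j)
        < (1 - 1 / 2) * edge_cost n A M (t0, i, j) + 1 / 2 * edge_cost n A N (t0, i, j)"
    proof -
      have half: "a < (1 - 1 / 2) * b + 1 / 2 * c" if "a < (b + c) / 2" for a b c :: real
        using that by simp
      show ?thesis
        unfolding edge_cost_def prod.case Z_entry Z_row row[OF ij(1), symmetric]
        by (rule half[OF strict])
    qed
    then show "\<exists>e\<in>edges. edge_cost n A Z e < (1 - 1 / 2) * edge_cost n A M e + 1 / 2 * edge_cost n A N e"
      using t0 ij by (auto simp: edges_def)
  qed (simp add: edges_def)
  also have "\<dots> = (F M + F N) / 2"
    by (simp add: F_def sum.distrib sum_distrib_left sum_divide_distrib add_divide_distrib)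
  finally have FZ: "F Z < (F M + F N) / 2" .
  \<comment> \<open>All three flows have the same image under \<open>L\<close>, so the proximal
    terms agree and \<open>F\<close> decides.\<close>
  have "kl_sum m (L Z) w = kl_sum m (L M) w" "kl_sum m (L N) w = kl_sum m (L M) w"
    using L_eq hs_less by (auto simp: kl_sum_def L_def Z_def row_mass_mix)
  then have "prox_cost e w Z < (prox_cost e w M + prox_cost e w N) / 2"
    using FZ by (simp add: prox_cost_def)
  moreover have "prox_cost e w N \<le> prox_cost e w M" using prox_minD(2)[OF N MK] .
  ultimately show False using prox_minD(2)[OF M ZK] by simp
qed

section \<open>Matrix divergences in terms of the abstract cost\<close>

text \<open>A general reference \<open>g\<close> serves two uses: the prescribed marginal at time 0,
  and at later times the row masses themselves, for which the second sum vanishes.\<close>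

lemma KL_mat_flow:
  assumes M: "flow_constraints n T ps \<rho> M" and t: "t < T"
    and v: "\<And>i. i < n \<Longrightarrow> row_mass n (M t) i \<noteq> 0 \<Longrightarrow> 0 < g i"
  shows "KL_mat (M t) (diag_of_vec (vec n g) * A t) =
    (if \<forall>i<n. \<forall>j<n. M t $$ (i, j) \<noteq> 0 \<longrightarrow> A t $$ (i, j) \<noteq> 0
     then ereal ((\<Sum>i<n. \<Sum>j<n. edge_cost n A M (t, i, j)) + (\<Sum>i<n. kl (row_mass n (M t) i) (g i)))
     else \<infinity>)"
proof -
  have prod: "diag_of_vec (vec n g) * A t = mat n n (\<lambda>(i, j). g i * A t $$ (i, j))"
    using mat_diag_mult_left[OF A_carrier[OF t]] by (auto simp: diag_of_vec_def intro!: eq_matI)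
  have dims: "dim_row (M t) = n" "dim_col (M t) = n" using flowD(1)[OF M t] by auto
  have g: "g i \<noteq> 0" if "i < n" "j < n" "M t $$ (i, j) \<noteq> 0" for i j
    using v[OF that(1)] row_mass_pos[OF M t that] by fastforce
  have supp: "(\<forall>ij\<in>{..<n} \<times> {..<n}. M t $$ ij \<noteq> 0 \<longrightarrow> (diag_of_vec (vec n g) * A t) $$ ij \<noteq> 0)
      \<longleftrightarrow> (\<forall>i<n. \<forall>j<n. M t $$ (i, j) \<noteq> 0 \<longrightarrow> A t $$ (i, j) \<noteq> 0)"
    using g by (auto simp: prod)
  have "(\<Sum>ij\<in>{..<n} \<times> {..<n}. M t $$ ij * ln (M t $$ ij / (diag_of_vec (vec n g) * A t) $$ ij) - M t $$ ij
      + (diag_of_vec (vec n g) * A t) $$ ij)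
    = (\<Sum>i<n. \<Sum>j<n. edge_cost n A M (t, i, j)) + (\<Sum>i<n. kl (row_mass n (M t) i) (g i))"
    if "\<forall>i<n. \<forall>j<n. M t $$ (i, j) \<noteq> 0 \<longrightarrow> A t $$ (i, j) \<noteq> 0"
  proof -
    have "(\<Sum>ij\<in>{..<n} \<times> {..<n}. M t $$ ij * ln (M t $$ ij / (diag_of_vec (vec n g) * A t) $$ ij) - M t $$ ij
      + (diag_of_vec (vec n g) * A t) $$ ij) = (\<Sum>i<n. \<Sum>j<n. kl (M t $$ (i, j)) (g i * A t $$ (i, j)))"
      unfolding sum.cartesian_product by (intro sum.cong) (auto simp: prod kl_def)
    also have "\<dots> = (\<Sum>i<n. (\<Sum>j<n. edge_cost n A M (t, i, j)) + kl (row_mass n (M t) i) (g i))"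
    proof (rule sum.cong[OF refl])
      fix i assume "i \<in> {..<n}"
      then have i: "i < n" by simp
      show "(\<Sum>j<n. kl (M t $$ (i, j)) (g i * A t $$ (i, j)))
        = (\<Sum>j<n. edge_cost n A M (t, i, j)) + kl (row_mass n (M t) i) (g i)"
        unfolding edge_cost_def prod.case
        using flowD(2)[OF M t i] A_nonneg[OF t i] that i A_row_sum[OF t i] row_mass_def v[OF i]
        by (intro kl_chain) auto
    qed
    finally show ?thesis by (simp add: sum.distrib)
  qed
  then show ?thesis unfolding KL_mat_def KL_def dims using supp by auto
qed

lemma marginal_vec:
  assumes "w \<in> carrier_vec m"
  shows "\<exists>g. transpose_mat (obs_mat n ps) *\<^sub>v \<rho> 0 + transpose_mat (hid_mat n ps) *\<^sub>v w = vec n g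
    \<and> (\<forall>a<length ps. g (ps ! a) = \<rho> 0 $ a) \<and> (\<forall>a<m. g (hs ! a) = w $ a)"
proof -
  define g where "g i = (\<Sum>a<length ps. if ps ! a = i then \<rho> 0 $ a else 0)
    + (\<Sum>a<m. if hs ! a = i then w $ a else 0)" for i
  have "transpose_mat (obs_mat n ps) *\<^sub>v \<rho> 0 + transpose_mat (hid_mat n ps) *\<^sub>v w = vec n g"
    using transpose_selection_mat_mult_vec[of "\<rho> 0" ps n] transpose_selection_mat_mult_vec[of w hs n]
      \<rho>_carrier assms length_hs
    by (simp add: obs_mat_def hid_mat_def hs_def[symmetric]) (auto intro!: eq_vecI simp: g_def)
  moreover have "g (ps ! a) = \<rho> 0 $ a" if a: "a < length ps" for a
  proof -
    have "ps ! b = ps ! a \<longleftrightarrow> b = a" if "b < length ps" for b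
      using nth_eq_iff_index_eq[OF distinct_ps that a] .
    then have "(\<Sum>b<length ps. if ps ! b = ps ! a then \<rho> 0 $ b else 0)
        = (\<Sum>b<length ps. if b = a then \<rho> 0 $ b else 0)" by (intro sum.cong) auto
    moreover have "hs ! b \<noteq> ps ! a" if "b < m" for b
      using that a set_hs length_hs nth_mem by (metis DiffD2)
    ultimately show ?thesis using a by (simp add: g_def)
  qed
  moreover have "g (hs ! a) = w $ a" if a: "a < m" for a
  proof -
    have "distinct hs" by (simp add: hs_def)
    then have "hs ! b = hs ! a \<longleftrightarrow> b = a" if "b < m" for b
      using nth_eq_iff_index_eq that a length_hs by metis
    then have "(\<Sum>b<m. if hs ! b = hs ! a then w $ b else 0)
        = (\<Sum>b<m. if b = a then w $ b else 0)" by (intro sum.cong) auto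
    moreover have "ps ! b \<noteq> hs ! a" if "b < length ps" for b
      using that a set_hs length_hs nth_mem by (metis DiffD2)
    ultimately show ?thesis using a by (simp add: g_def)
  qed
  ultimately show ?thesis by blast
qed

text \<open>At observed coordinates the row mass equals the reference, so only hidden coordinates
  leave a divergence. The condition on \<open>w\<close> admits positive vectors as well as the
  marginal of \<open>M\<close> itself, which may have zeros.\<close>

lemma flow_cost_eq:
  assumes M: "flow_constraints n T ps \<rho> M" and w: "w \<in> carrier_vec m"
    and pos: "\<And>a. a < m \<Longrightarrow> L M a \<noteq> 0 \<Longrightarrow> 0 < w $ a"
  shows "flow_cost n T ps A \<rho> w M = (if M \<in> K then ereal (F M + kl_sum m (L M) (($) w)) else \<infinity>)"
proof -
  define supp where "supp t \<longleftrightarrow> (\<forall>i<n. \<forall>j<n. M t $$ (i, j) \<noteq> 0 \<longrightarrow> A t $$ (i, j) \<noteq> 0)" for t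
  define c where "c t = (\<Sum>i<n. \<Sum>j<n. edge_cost n A M (t, i, j))" for t
  define k where "k = kl_sum m (L M) (($) w)"
  obtain g where g: "transpose_mat (obs_mat n ps) *\<^sub>v \<rho> 0 + transpose_mat (hid_mat n ps) *\<^sub>v w = vec n g"
    "\<forall>a<length ps. g (ps ! a) = \<rho> 0 $ a" "\<forall>a<m. g (hs ! a) = w $ a"
    using marginal_vec[OF w] by blast
  have T0: "0 < T" using T by simp
  have gpos: "0 < g i" if i: "i < n" "row_mass n (M 0) i \<noteq> 0" for i
  proof -
    have "i \<in> set ps \<or> i \<in> set hs" using i by (auto simp: set_hs)
    then show ?thesis
    proof
      assume "i \<in> set ps"
      then obtain a where "a < length ps" "i = ps ! a" by (metis in_set_conv_nth)
      then show ?thesis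
        using flowD(3)[OF M T0] g(2) i row_mass_nonneg[OF M T0 i(1)] by simp
    next
      assume "i \<in> set hs"
      then obtain a where "a < m" "i = hs ! a" by (metis in_set_conv_nth length_hs)
      then show ?thesis using pos g(3) i by (simp add: L_def)
    qed
  qed
  have "(\<Sum>i<n. kl (row_mass n (M 0) i) (g i)) = k"
    using flowD(3)[OF M T0] g by (simp add: sum_split k_def kl_sum_def L_def)
  moreover have "KL_mat (M 0) (diag_of_vec (vec n g) * A 0)
      = (if supp 0 then ereal (c 0 + (\<Sum>i<n. kl (row_mass n (M 0) i) (g i))) else \<infinity>)"
    unfolding supp_def c_def by (rule KL_mat_flow[OF M T0 gpos])
  ultimately have first: "KL_mat (M 0) (diag_of_vec (vec n g) * A 0) = (if supp 0 then ereal (c 0 + k) else \<infinity>)"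
    by (simp only:)
  have rest: "KL_mat (M t) (diag_of_vec (M t *\<^sub>v ones_vec n) * A t) = (if supp t then ereal (c t) else \<infinity>)"
    if "t < T" for t
  proof -
    have "M t *\<^sub>v ones_vec n = vec n (row_mass n (M t))"
      using mult_ones_vec[OF flowD(1)[OF M that]] by (simp add: row_mass_def[abs_def])
    moreover have "KL_mat (M t) (diag_of_vec (vec n (row_mass n (M t))) * A t)
      = (if supp t then ereal (c t + (\<Sum>i<n. kl (row_mass n (M t) i) (row_mass n (M t) i))) else \<infinity>)"
      unfolding supp_def c_def
    proof (rule KL_mat_flow[OF M that])
      fix i assume "i < n" "row_mass n (M t) i \<noteq> 0"
      then show "0 < row_mass n (M t) i" using row_mass_nonneg[OF M that] by fastforce
    qed
    ultimately show ?thesis by (simp only: kl_refl sum.neutral_const add_0_right)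
  qed
  have cost: "flow_cost n T ps A \<rho> w M = (if supp 0 then ereal (c 0 + k) else \<infinity>)
      + (\<Sum>t=1..<T. if supp t then ereal (c t) else \<infinity>)"
    unfolding flow_cost_def g(1) first using rest by (intro arg_cong2[where f = "(+)"] sum.cong) auto
  have MK: "M \<in> K \<longleftrightarrow> (\<forall>t<T. supp t)" using M by (auto simp: K_def feasible_P_def supp_def)
  show ?thesis
  proof (cases "M \<in> K")
    case True
    then have "flow_cost n T ps A \<rho> w M = ereal (c 0 + k) + (\<Sum>t=1..<T. ereal (c t))"
      unfolding cost using T0 MK by (auto intro!: arg_cong2[where f = "(+)"] sum.cong)
    also have "\<dots> = ereal ((c 0 + sum c {1..<T}) + k)" by (simp add: add_ac)
    also have "c 0 + sum c {1..<T} = sum c {..<T}"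
      using T0 by (simp add: lessThan_atLeast0 sum.atLeast_Suc_lessThan)
    also have "\<dots> = F M"
      unfolding c_def F_def edges_def sum.cartesian_product by simp
    finally show ?thesis using True by (simp add: k_def)
  next
    case False
    then obtain t where t: "t < T" "\<not> supp t" using MK by blast
    have "flow_cost n T ps A \<rho> w M = \<infinity>"
    proof (cases t)
      case (Suc t')
      then have "(\<Sum>t=1..<T. if supp t then ereal (c t) else \<infinity>) = \<infinity>"
        unfolding sum_Pinfty using t by (auto intro!: bexI[of _ t])
      then show ?thesis unfolding cost by simp
    qed (use t cost in simp)
    then show ?thesis using False by simp
  qed
qed

lemma hid_marginal_eq:
  assumes "flow_constraints n T ps \<rho> M"
  shows "hid_marginal n ps M = vec m (L M)"
proof -
  have "M 0 *\<^sub>v ones_vec n = vec n (row_mass n (M 0))"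
    using mult_ones_vec[OF flowD(1)[OF assms, of 0]] T by (simp add: row_mass_def[abs_def])
  then show ?thesis
    using selection_mat_mult_vec[of hs n "row_mass n (M 0)"] set_hs
    by (simp add: hid_marginal_def hid_mat_def hs_def[symmetric] length_hs L_def[abs_def])
qed

lemma flow_cost_fiber:
  assumes M: "flow_constraints n T ps \<rho> M" and w: "hid_marginal n ps M = w"
  shows "flow_cost n T ps A \<rho> w M = (if M \<in> K then ereal (F M) else \<infinity>)"
proof -
  have L: "L M a = w $ a" if "a < m" for a using w that unfolding hid_marginal_eq[OF M] by auto
  have "0 \<le> L M a" if "a < m" for a
    using row_mass_nonneg[OF M, of 0] T hs_less[OF that] by (simp add: L_def)
  moreover have "w \<in> carrier_vec m" using w unfolding hid_marginal_eq[OF M] by auto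
  moreover have "kl_sum m (L M) (($) w) = 0" using L by (simp add: kl_sum_def)
  ultimately show ?thesis using flow_cost_eq[OF M, of w] L by (auto simp: less_le)
qed

lemma reduced_cost_le:
  assumes "M \<in> K"
  shows "reduced_cost n T ps A \<rho> (vec m (L M)) \<le> ereal (F M)"
proof -
  note M = K_D(1)[OF assms] 
  have "reduced_cost n T ps A \<rho> (vec m (L M)) \<le> flow_cost n T ps A \<rho> (vec m (L M)) M"
    unfolding reduced_cost_def using M hid_marginal_eq[OF M] by (intro INF_lower) simp
  then show ?thesis using flow_cost_fiber[OF M hid_marginal_eq[OF M]] assms by simp
qed

text \<open>This includes empty fibres, for instance over vectors with a negative entry, where the
  value is \<open>\<infinity>\<close>.\<close>

lemma reduced_cost_ge:
  assumes "\<And>M. M \<in> K \<Longrightarrow> vec m (L M) = \<eta> \<Longrightarrow> c \<le> F M"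
  shows "ereal c \<le> reduced_cost n T ps A \<rho> \<eta>"
  unfolding reduced_cost_def
proof (rule INF_greatest)
  fix M assume "M \<in> {M. flow_constraints n T ps \<rho> M \<and> hid_marginal n ps M = \<eta>}"
  then show "ereal c \<le> flow_cost n T ps A \<rho> \<eta> M"
    using flow_cost_fiber[of M \<eta>] assms[of M] hid_marginal_eq[of M] by auto
qed

lemma reduced_cost_minimizer:
  assumes "is_arg_min F (\<lambda>M. M \<in> K) M"
  shows "is_arg_min (reduced_cost n T ps A \<rho>) (\<lambda>\<eta>. \<eta> \<in> carrier_vec m) (vec m (L M))"
proof -
  have M: "M \<in> K" "\<And>N. N \<in> K \<Longrightarrow> F M \<le> F N" using assms by (auto simp: is_arg_min_linorder)
  then have "ereal (F M) \<le> reduced_cost n T ps A \<rho> \<eta>" for \<eta> by (intro reduced_cost_ge) auto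
  then show ?thesis using reduced_cost_le[OF M(1)] unfolding is_arg_min_linorder by (auto intro: order_trans)
qed

text \<open>By the three-point inequality on each fibre, the objective at \<open>\<eta>\<close>
  exceeds the optimal value by at least \<open>e\<close> times the divergence of
  \<open>\<eta>\<close> from \<open>L M\<close>. This gives optimality and uniqueness
  together.\<close>

lemma prox_argmin_eq:
  assumes w: "pos_vec m w" and e: "0 < e" and M: "prox_min e (($) w) M"
  shows "prox_argmin m (reduced_cost n T ps A \<rho>) e w = {vec m (L M)}"
proof -
  let ?f = "reduced_cost n T ps A \<rho>"
  let ?\<Phi> = "\<lambda>\<eta>. ?f \<eta> + ereal e * KL_vec \<eta> w"
  define c where "c = prox_cost e (($) w) M"
  have wpos: "0 < w $ i" if "i < m" for i using w that by (simp add: pos_vec_def)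
  have MK: "M \<in> K" using prox_minD(1)[OF M] .
  have KL: "KL_vec \<eta> w = ereal (kl_sum m (($) \<eta>) (($) w))" if "\<eta> \<in> carrier_vec m" for \<eta>
  proof -
    have "\<forall>i<m. w $ i \<noteq> 0" using wpos by fastforce
    then show ?thesis using that by (auto simp: KL_vec_def KL_def kl_sum_def kl_def)
  qed
  have lower: "ereal (c + e * kl_sum m (($) \<eta>) (L M)) \<le> ?\<Phi> \<eta>" if \<eta>: "\<eta> \<in> carrier_vec m" for \<eta>
  proof -
    \<comment> \<open>The finite divergence is subtracted among reals first, since cancellation
      fails at \<open>\<infinity>\<close>.\<close>
    have "ereal (c + e * kl_sum m (($) \<eta>) (L M) - e * kl_sum m (($) \<eta>) (($) w)) \<le> ?f \<eta>"
    proof (rule reduced_cost_ge)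
      fix N assume N: "N \<in> K" "vec m (L N) = \<eta>"
      then have "kl_sum m (($) \<eta>) v = kl_sum m (L N) v" for v by (auto simp: kl_sum_def)
      then show "c + e * kl_sum m (($) \<eta>) (L M) - e * kl_sum m (($) \<eta>) (($) w) \<le> F N"
        using prox_min_three_point[OF e wpos M N(1)] by (simp add: c_def prox_cost_def)
    qed
    then have "ereal (c + e * kl_sum m (($) \<eta>) (L M) - e * kl_sum m (($) \<eta>) (($) w))
        + ereal (e * kl_sum m (($) \<eta>) (($) w)) \<le> ?\<Phi> \<eta>"
      unfolding KL[OF \<eta>] by (intro add_mono) auto
    then show ?thesis by simp
  qed
  have nn: "0 \<le> kl_sum m (($) \<eta>) (L M)" if "\<eta> \<in> carrier_vec m" "0\<^sub>v m \<le> \<eta>" for \<eta>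
    using that prox_min_pos[OF e wpos M] by (intro kl_sum_nonneg) (auto simp: less_eq_vec_def)
  have upper: "?\<Phi> (vec m (L M)) \<le> ereal c"
  proof -
    have "kl_sum m (($) (vec m (L M))) (($) w) = kl_sum m (L M) (($) w)" by (simp add: kl_sum_def)
    then have "?\<Phi> (vec m (L M)) \<le> ereal (F M) + ereal (e * kl_sum m (L M) (($) w))"
      using reduced_cost_le[OF MK] KL[of "vec m (L M)"]
      by (simp add: add_right_mono del: plus_ereal.simps)
    then show ?thesis by (simp add: c_def prox_cost_def)
  qed
  have dom: "vec m (L M) \<in> carrier_vec m" "0\<^sub>v m \<le> vec m (L M)"
    using L_nonneg[OF MK] by (auto simp: less_eq_vec_def)
  show ?thesis
  proof (intro Set.set_eqI iffI)
    fix \<eta> assume "\<eta> \<in> prox_argmin m ?f e w"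
    then have \<eta>: "\<eta> \<in> carrier_vec m" "0\<^sub>v m \<le> \<eta>" "?\<Phi> \<eta> \<le> ?\<Phi> (vec m (L M))"
      using dom by (auto simp: prox_argmin_def is_arg_min_linorder)
    then have "ereal (c + e * kl_sum m (($) \<eta>) (L M)) \<le> ereal c"
      using lower[OF \<eta>(1)] upper by (meson order_trans)
    then have "kl_sum m (($) \<eta>) (L M) \<le> 0" using e by (simp add: mult_le_0_iff)
    then have "\<eta> $ i = L M i" if "i < m" for i
      using kl_sum_eq_zero[of m "($) \<eta>" "L M" i] that \<eta> prox_min_pos[OF e wpos M]
      by (auto simp: less_eq_vec_def)
    then show "\<eta> \<in> {vec m (L M)}" using \<eta>(1) by auto
  next
    fix \<eta> assume "\<eta> \<in> {vec m (L M)}"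
    moreover have "?\<Phi> (vec m (L M)) \<le> ?\<Phi> \<zeta>" if "\<zeta> \<in> carrier_vec m" "0\<^sub>v m \<le> \<zeta>" for \<zeta>
    proof -
      have "ereal c \<le> ereal (c + e * kl_sum m (($) \<zeta>) (L M))" using nn[OF that] e by simp
      then show ?thesis using lower[OF that(1)] upper by (meson order_trans)
    qed
    ultimately show "\<eta> \<in> prox_argmin m ?f e w"
      using dom by (simp add: prox_argmin_def is_arg_min_linorder)
  qed
qed

text \<open>The flow problem contains the divergence of the hidden marginal with coefficient 1. A
  minimizer has finite cost because \<open>M0\<close> has, and this places it in
  \<open>K\<close>.\<close>

lemma flow_minimizer_iff:
  assumes w: "pos_vec m w"
  shows "is_arg_min (flow_cost n T ps A \<rho> w) (flow_constraints n T ps \<rho>) M \<longleftrightarrow> prox_min 1 (($) w) M"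
proof -
  have cost: "flow_cost n T ps A \<rho> w M = (if M \<in> K then ereal (prox_cost 1 (($) w) M) else \<infinity>)"
    if "flow_constraints n T ps \<rho> M" for M
    using flow_cost_eq[OF that, of w] w by (simp add: pos_vec_def prox_cost_def)
  have K_flow: "flow_constraints n T ps \<rho> N" if "N \<in> K" for N using K_D(1)[OF that] .
  show ?thesis
  proof
    assume *: "is_arg_min (flow_cost n T ps A \<rho> w) (flow_constraints n T ps \<rho>) M"
    then have M: "flow_constraints n T ps \<rho> M" by (simp add: is_arg_min_linorder)
    have le: "flow_cost n T ps A \<rho> w M \<le> ereal (prox_cost 1 (($) w) N)" if "N \<in> K" for N
    proof -
      have "flow_cost n T ps A \<rho> w M \<le> flow_cost n T ps A \<rho> w N"
        using * K_flow[OF that] by (simp add: is_arg_min_linorder)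
      then show ?thesis using cost[OF K_flow[OF that]] that by simp
    qed
    have "M \<in> K" using le[OF x0] cost[OF M] by (auto split: if_splits)
    then show "prox_min 1 (($) w) M" using le cost[OF M] by (simp add: prox_min_def is_arg_min_linorder)
  next
    assume "prox_min 1 (($) w) M"
    then show "is_arg_min (flow_cost n T ps A \<rho> w) (flow_constraints n T ps \<rho>) M"
      using K_flow cost prox_minD by (auto simp: is_arg_min_linorder)
  qed
qed

subsection \<open>Existence of a minimizer\<close>

text \<open>With \<open>d\<close> steps to go, mass in \<open>trap d\<close> that follows the chain \<open>A\<close> is never observed.\<close>

primrec trap :: "nat \<Rightarrow> nat set" where
  "trap 0 = {i. i < n \<and> i \<notin> set ps}"
| "trap (Suc d) = {i. i < n \<and> i \<notin> set ps \<and> (\<forall>j<n. A (T - Suc d) $$ (i, j) \<noteq> 0 \<longrightarrow> j \<in> trap d)}"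

text \<open>Covers the final time \<open>T\<close> too, from which no matrix departs.\<close>

definition node_mass :: "(nat \<Rightarrow> real mat) \<Rightarrow> nat \<Rightarrow> nat \<Rightarrow> real" where
  "node_mass M t i = (if t < T then row_mass n (M t) i else col_mass n (M (T - 1)) i)"

lemma node_mass_Suc:
  assumes "M \<in> K" "t < T" "j < n"
  shows "node_mass M (Suc t) j = col_mass n (M t) j"
proof (cases "Suc t < T")
  case False
  then have "T - 1 = t" using assms by simp
  then show ?thesis using False by (simp add: node_mass_def)
qed (use flowD(5)[OF K_D(1)[OF assms(1)]] assms in \<open>simp add: node_mass_def\<close>)

lemma node_mass_obs:
  assumes "M \<in> K" "t \<le> T" "a < length ps"
  shows "node_mass M t (ps ! a) = \<rho> t $ a"
  using flowD(3,4)[OF K_D(1)[OF assms(1)]] assms by (cases "t = T") (auto simp: node_mass_def)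

lemma trap_hidden: "i \<in> trap d \<Longrightarrow> i < n \<and> i \<notin> set ps"
  by (cases d) auto

lemma trap_step:
  assumes "t < T" "i \<in> trap (T - t)" "j < n" "A t $$ (i, j) \<noteq> 0"
  shows "j \<in> trap (T - Suc t)"
proof -
  have "T - t = Suc (T - Suc t)" "T - Suc (T - Suc t) = t" using assms(1) by auto
  then show ?thesis using assms by simp
qed

text \<open>Much mass at \<open>i\<close> with little of it on an edge that \<open>A\<close> uses
  must be expensive. The constant comes from the tangent with \<open>c = exp (- 1)\<close>; any
  \<open>c\<close> strictly between 0 and 1 gives a bound of this kind.\<close>

lemma entry_cost_bound:
  assumes M: "M \<in> K" and t: "t < T" "i < n" "j < n" and a: "A t $$ (i, j) \<noteq> 0"
  shows "row_mass n (M t) i \<le> (F M + M t $$ (i, j)) / (A t $$ (i, j) * (1 - exp (- 1)))"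
proof -
  let ?y = "row_mass n (M t) i * A t $$ (i, j)"
  have "M t $$ (i, j) * ln (exp (- 1)) + ?y - ?y * exp (- 1) \<le> kl (M t $$ (i, j)) ?y"
    using edge_cost_pre[OF M t] by (intro kl_ge_tangent) auto
  also have "\<dots> \<le> F M"
    using edge_cost_le_F[OF M, of "(t, i, j)"] t by (simp add: edges_def edge_cost_def)
  finally have "row_mass n (M t) i * (A t $$ (i, j) * (1 - exp (- 1))) \<le> F M + M t $$ (i, j)"
    by (simp add: algebra_simps)
  moreover have "0 < A t $$ (i, j) * (1 - exp (- 1))"
    using A_nonneg[OF t] a by simp
  ultimately show ?thesis by (simp add: pos_le_divide_eq)
qed

text \<open>Backward in time: a state outside the trap is observed, with prescribed mass, or has an
  edge of \<open>A\<close> to a state outside the next trap. In the second case the bounded target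
  mass bounds the entry on that edge, and cost and entry together bound the row mass.\<close>

lemma mass_outside_trap_bounded:
  "d \<le> T \<Longrightarrow> \<exists>B. \<forall>M\<in>K. F M \<le> c \<longrightarrow> (\<forall>i<n. i \<notin> trap d \<longrightarrow> node_mass M (T - d) i \<le> B)"
proof (induction d)
  case 0
  have "node_mass M T i \<le> (\<Sum>a<length ps. \<bar>\<rho> T $ a\<bar>)" if M: "M \<in> K" and i: "i < n" "i \<notin> trap 0" for M i
  proof -
    obtain a where a: "a < length ps" "i = ps ! a" using i by (auto simp: in_set_conv_nth)
    then have "node_mass M T i \<le> \<bar>\<rho> T $ a\<bar>" using node_mass_obs[OF M, of T a] by simp
    also have "\<dots> \<le> (\<Sum>a<length ps. \<bar>\<rho> T $ a\<bar>)" using a by (intro member_le_sum) auto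
    finally show ?thesis .
  qed
  then show ?case by auto
next
  case (Suc d)
  then obtain B where B: "\<And>M i. M \<in> K \<Longrightarrow> F M \<le> c \<Longrightarrow> i < n \<Longrightarrow> i \<notin> trap d \<Longrightarrow> node_mass M (T - d) i \<le> B"
    by (meson Suc_leD)
  define t where "t = T - Suc d"
  have t: "t < T" "T - d = Suc t" using Suc.prems by (auto simp: t_def)
  \<comment> \<open>The absolute value keeps \<open>q\<close> nonnegative, so that a single term is
    at most the double sum \<open>Q\<close>.\<close>
  define q where "q i j = \<bar>c + B\<bar> / (A t $$ (i, j) * (1 - exp (- 1)))" for i j
  have q: "0 \<le> q i j" if "i < n" "j < n" for i j using A_nonneg[OF t(1) that] by (simp add: q_def)
  define R where "R = (\<Sum>a<length ps. \<bar>\<rho> t $ a\<bar>)"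
  define Q where "Q = (\<Sum>i<n. \<Sum>j<n. q i j)"
  have "node_mass M t i \<le> R + Q"
    if M: "M \<in> K" "F M \<le> c" and i: "i < n" "i \<notin> trap (Suc d)" for M i
  proof -
    have "0 \<le> R" unfolding R_def by (intro sum_nonneg) auto
    have "0 \<le> Q" unfolding Q_def using q by (intro sum_nonneg) auto
    consider "i \<in> set ps" | j where "j < n" "A t $$ (i, j) \<noteq> 0" "j \<notin> trap d"
      using i by (auto simp: t_def)
    then show ?thesis
    proof cases
      case 1
      then obtain a where a: "a < length ps" "i = ps ! a" by (auto simp: in_set_conv_nth)
      then have "node_mass M t i \<le> \<bar>\<rho> t $ a\<bar>" using node_mass_obs[OF M(1), of t a] t by simp
      also have "\<dots> \<le> R" unfolding R_def using a by (intro member_le_sum) auto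
      finally show ?thesis using \<open>0 \<le> Q\<close> by simp
    next
      case 2
      have "M t $$ (i, j) \<le> B"
        using entry_le_col_mass[OF K_D(1)[OF M(1)] t(1) i(1) 2(1)] B[OF M 2(1,3)]
          node_mass_Suc[OF M(1) t(1) 2(1)] t(2) by simp
      then have "F M + M t $$ (i, j) \<le> \<bar>c + B\<bar>" using M(2) by simp
      then have "(F M + M t $$ (i, j)) / (A t $$ (i, j) * (1 - exp (- 1))) \<le> q i j"
        unfolding q_def using A_nonneg[OF t(1) i(1) 2(1)] by (intro divide_right_mono) auto
      then have "node_mass M t i \<le> q i j"
        using entry_cost_bound[OF M(1) t(1) i(1) 2(1,2)] t(1) by (simp add: node_mass_def)
      also have "\<dots> \<le> (\<Sum>j<n. q i j)" using q i 2 by (intro member_le_sum) auto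
      also have "\<dots> \<le> Q" unfolding Q_def using q i by (intro member_le_sum sum_nonneg) auto
      finally show ?thesis using \<open>0 \<le> R\<close> by simp
    qed
  qed
  then show ?case unfolding t_def by blast
qed

text \<open>Delete the mass that starts in the trap and let all mass entering it later follow \<open>A\<close>.\<close>

primrec released_mass :: "(nat \<Rightarrow> real mat) \<Rightarrow> nat \<Rightarrow> nat \<Rightarrow> real" where
  "released_mass M 0 = (\<lambda>i. if i \<in> trap T then 0 else row_mass n (M 0) i)"
| "released_mass M (Suc t) = (\<lambda>j. \<Sum>i<n.
    if i \<in> trap (T - t) then released_mass M t i * A t $$ (i, j) else M t $$ (i, j))"

definition released :: "(nat \<Rightarrow> real mat) \<Rightarrow> nat \<Rightarrow> real mat" where
  "released M t = mat n n (\<lambda>(i, j).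
    if i \<in> trap (T - t) then released_mass M t i * A t $$ (i, j) else M t $$ (i, j))"

text \<open>An edge from the trap to a state outside the next trap has \<open>A\<close> equal to 0,
  so it is empty both before and after the change. States outside thus receive exactly what they
  received before.\<close>

lemma released_mass_outside:
  assumes M: "M \<in> K"
  shows "t \<le> T \<Longrightarrow> j < n \<Longrightarrow> j \<notin> trap (T - t) \<Longrightarrow> released_mass M t j = node_mass M t j"
proof (cases t)
  case (Suc s)
  assume *: "t \<le> T" "j < n" "j \<notin> trap (T - t)"
  then have s: "s < T" using Suc by simp
  have "(if i \<in> trap (T - s) then released_mass M s i * A s $$ (i, j) else M s $$ (i, j)) = M s $$ (i, j)"
    if i: "i < n" for i
  proof (cases "i \<in> trap (T - s)")
    case True
    then have "A s $$ (i, j) = 0" using trap_step[OF s True *(2)] * Suc by blast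
    then show ?thesis using K_D(2)[OF M s i *(2)] by auto
  qed simp
  then have "released_mass M t j = col_mass n (M s) j"
    unfolding Suc col_mass_def by (auto intro!: sum.cong)
  then show ?thesis using node_mass_Suc[OF M s *(2)] Suc by simp
qed (use T in \<open>simp add: node_mass_def\<close>)

lemma released_mass_nonneg:
  assumes M: "M \<in> K"
  shows "t \<le> T \<Longrightarrow> i < n \<Longrightarrow> 0 \<le> released_mass M t i"
proof (induction t arbitrary: i)
  case 0
  then show ?case using row_mass_nonneg[OF K_D(1)[OF M], of 0 i] T by simp
next
  case (Suc t)
  then show ?case
    using A_nonneg[of t] flowD(2)[OF K_D(1)[OF M], of t] by (auto intro!: sum_nonneg)
qed

lemma row_mass_released:
  assumes M: "M \<in> K" and t: "t < T" "i < n"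
  shows "row_mass n (released M t) i = released_mass M t i"
proof (cases "i \<in> trap (T - t)")
  case True
  then have "row_mass n (released M t) i = released_mass M t i * (\<Sum>j<n. A t $$ (i, j))"
    using t by (simp add: row_mass_def released_def sum_distrib_left)
  then show ?thesis using A_row_sum[OF t] by simp
next
  case False
  then have "row_mass n (released M t) i = row_mass n (M t) i"
    using t by (simp add: row_mass_def released_def)
  then show ?thesis using released_mass_outside[OF M _ t(2) False] t by (simp add: node_mass_def)
qed

lemma col_mass_released: "j < n \<Longrightarrow> col_mass n (released M t) j = released_mass M (Suc t) j"
  by (simp add: col_mass_def released_def)

text \<open>Observed states lie outside every trap, so the prescribed masses are untouched.\<close>

lemma released_in_K:
  assumes M: "M \<in> K"
  shows "released M \<in> K"
proof (rule K_I)
  have obs: "released_mass M t (ps ! a) = \<rho> t $ a" if "t \<le> T" "a < length ps" for t a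
    using released_mass_outside[OF M that(1) ps_less[OF that(2)]] node_mass_obs[OF M that]
      trap_hidden that(2) nth_mem by metis
  fix a assume a: "a < length ps"
  show "col_mass n (released M (T - 1)) (ps ! a) = \<rho> T $ a"
    using obs[of T a] a T ps_less[OF a] by (simp add: col_mass_released del: released_mass.simps)
  fix t assume t: "t < T"
  show "row_mass n (released M t) (ps ! a) = \<rho> t $ a"
    using obs[of t a] a t ps_less[OF a] row_mass_released[OF M t] by simp
next
  fix t i assume t: "Suc t < T" "i < n"
  show "row_mass n (released M (Suc t)) i = col_mass n (released M t) i"
    using row_mass_released[OF M t] col_mass_released[OF t(2)] by simp
next
  fix t i j assume t: "t < T" "i < n" "j < n"
  show "0 \<le> released M t $$ (i, j)"
    using t A_nonneg[OF t] flowD(2)[OF K_D(1)[OF M] t] released_mass_nonneg[OF M, of t i]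
    by (simp add: released_def)
  show "A t $$ (i, j) \<noteq> 0" if "released M t $$ (i, j) \<noteq> 0"
    using that t K_D(2)[OF M t] by (auto simp: released_def split: if_splits)
qed (simp add: released_def)

text \<open>Rows in the trap follow \<open>A\<close> exactly and cost 0; the other rows are
  unchanged, together with their masses.\<close>

lemma F_released_le:
  assumes M: "M \<in> K"
  shows "F (released M) \<le> F M"
  unfolding F_def
proof (rule sum_mono)
  fix e assume e: "e \<in> edges"
  then obtain t i j where [simp]: "e = (t, i, j)" and t: "t < T" "i < n" "j < n"
    by (auto simp: edges_def)
  show "edge_cost n A (released M) e \<le> edge_cost n A M e"
  proof (cases "i \<in> trap (T - t)")
    case True
    then have "edge_cost n A (released M) e = 0"
      using t by (simp add: edge_cost_def row_mass_released[OF M]) (simp add: released_def)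
    then show ?thesis using edge_cost_nonneg[OF M e] by simp
  next
    case False
    then have "row_mass n (released M t) i = row_mass n (M t) i"
      using t by (simp add: row_mass_def released_def)
    then show ?thesis using False t by (simp add: edge_cost_def) (simp add: released_def)
  qed
qed

lemma F_minimizer_exists: "\<exists>M. is_arg_min F (\<lambda>M. M \<in> K) M"
proof (rule minimizer_exists)
  fix c
  obtain B where B: "\<And>M i. M \<in> K \<Longrightarrow> F M \<le> c \<Longrightarrow> i < n \<Longrightarrow> i \<notin> trap T \<Longrightarrow> node_mass M 0 i \<le> B"
    using mass_outside_trap_bounded[of T c] by auto
  \<comment> \<open>The initial mass is 0 inside the trap and at most \<open>B\<close> outside,
    whence \<open>max 0 B\<close>.\<close>
  have "released M \<in> K \<and> F (released M) \<le> F M \<and> (\<forall>a<m. L (released M) a \<le> max 0 B)"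
    if M: "M \<in> K" "F M \<le> c" for M
  proof -
    have "L (released M) a \<le> max 0 B" if a: "a < m" for a
      using B[OF M hs_less[OF a]] T hs_less[OF a] row_mass_released[OF M(1)]
      by (auto simp: L_def node_mass_def)
    then show ?thesis using released_in_K[OF M(1)] F_released_le[OF M(1)] by blast
  qed
  then show "\<exists>B. \<forall>x\<in>K. F x \<le> c \<longrightarrow> (\<exists>y\<in>K. F y \<le> F x \<and> (\<forall>i<m. L y i \<le> B))" by blast
qed

subsection \<open>Proximal sequences\<close>

lemma prox_argmin_step:
  assumes w: "pos_vec m w" and e: "0 < e"
  obtains M where "prox_min e (($) w) M" "pos_vec m (vec m (L M))"
    "prox_argmin m (reduced_cost n T ps A \<rho>) e w = {vec m (L M)}"
proof -
  have wpos: "0 < w $ i" if "i < m" for i using w that by (simp add: pos_vec_def)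
  obtain M where M: "prox_min e (($) w) M" using prox_min_exists[of e "($) w"] e wpos by blast
  have "0 < L M i" if "i < m" for i by (rule prox_min_pos[OF e wpos M that])
  then have "pos_vec m (vec m (L M))" by (simp add: pos_vec_def)
  then show ?thesis using that M prox_argmin_eq[OF w e M] by blast
qed

lemma prox_sequence_exists:
  assumes "pos_vec m \<eta>0" "\<And>j. j \<ge> 1 \<Longrightarrow> \<epsilon> j > 0"
  shows "\<exists>\<eta>. prox_sequence m (reduced_cost n T ps A \<rho>) \<epsilon> \<eta>0 \<eta>"
proof -
  \<comment> \<open>Positivity is carried through the choice, because the next argmin is known to be
    nonempty only around a positive vector.\<close>
  have "\<exists>\<eta>. \<forall>j. (pos_vec m (\<eta> j) \<and> (j = 0 \<longrightarrow> \<eta> j = \<eta>0)) \<and>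
      \<eta> (Suc j) \<in> prox_argmin m (reduced_cost n T ps A \<rho>) (\<epsilon> (Suc j)) (\<eta> j)"
  proof (rule dependent_nat_choice)
    fix w and j :: nat assume "pos_vec m w \<and> (j = 0 \<longrightarrow> w = \<eta>0)"
    then show "\<exists>w'. (pos_vec m w' \<and> (Suc j = 0 \<longrightarrow> w' = \<eta>0)) \<and>
        w' \<in> prox_argmin m (reduced_cost n T ps A \<rho>) (\<epsilon> (Suc j)) w"
      using prox_argmin_step[of w "\<epsilon> (Suc j)"] assms(2)[of "Suc j"] by (metis insertI1 le_add1 nat.simps(3) plus_1_eq_Suc)
  qed (use assms(1) in auto)
  then obtain \<eta> where \<eta>: "\<eta> 0 = \<eta>0"
    "\<And>j. \<eta> (Suc j) \<in> prox_argmin m (reduced_cost n T ps A \<rho>) (\<epsilon> (Suc j)) (\<eta> j)" by auto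
  have "\<eta> j \<in> prox_argmin m (reduced_cost n T ps A \<rho>) (\<epsilon> j) (\<eta> (j - 1))" if "j \<ge> 1" for j
    using \<eta>(2)[of "j - 1"] that by simp
  then show ?thesis using \<eta>(1) unfolding prox_sequence_def by blast
qed

lemma prox_sequence_step:
  assumes "prox_sequence m (reduced_cost n T ps A \<rho>) \<epsilon> \<eta>0 \<eta>"
  shows "\<eta> (Suc j) \<in> prox_argmin m (reduced_cost n T ps A \<rho>) (\<epsilon> (Suc j)) (\<eta> j)"
  using assms unfolding prox_sequence_def by (metis diff_Suc_1 le_add1 plus_1_eq_Suc)

lemma prox_sequence_pos:
  assumes \<eta>: "prox_sequence m (reduced_cost n T ps A \<rho>) \<epsilon> \<eta>0 \<eta>"
    and "pos_vec m \<eta>0" "\<And>j. j \<ge> 1 \<Longrightarrow> \<epsilon> j > 0"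
  shows "pos_vec m (\<eta> j)"
proof (induction j)
  case 0
  then show ?case using assms by (simp add: prox_sequence_def)
next
  case (Suc j)
  have "0 < \<epsilon> (Suc j)" using assms(3) by simp
  then show ?case using prox_argmin_step[OF Suc] prox_sequence_step[OF \<eta>, of j] by (metis singletonD)
qed

text \<open>Here \<open>\<epsilon>\<close> is indexed by the iterate that a step produces, in the
  abstract theorem by the iterate it starts from; hence the shift by one.\<close>

lemma prox_sequence_converges:
  assumes \<eta>: "prox_sequence m (reduced_cost n T ps A \<rho>) \<epsilon> \<eta>0 \<eta>"
    and pos: "pos_vec m \<eta>0" "\<And>j. j \<ge> 1 \<Longrightarrow> \<epsilon> j > 0"
    and diverge: "\<not> summable (\<lambda>j. 1 / \<epsilon> (Suc j))"
  shows "\<exists>\<eta>s. is_arg_min (reduced_cost n T ps A \<rho>) (\<lambda>x. x \<in> carrier_vec m) \<eta>s \<and> vec_tendsto m \<eta> \<eta>s"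
proof -
  have e: "0 < \<epsilon> (Suc j)" for j using pos(2) by simp
  have \<eta>_pos: "pos_vec m (\<eta> j)" for j by (rule prox_sequence_pos[OF \<eta> pos])
  have "\<exists>M. prox_min (\<epsilon> (Suc j)) (($) (\<eta> j)) M \<and> \<eta> (Suc j) = vec m (L M)" for j
    using prox_argmin_step[OF \<eta>_pos[of j] e[of j]] prox_sequence_step[OF \<eta>, of j]
    by (metis singletonD)
  then obtain X where X: "\<And>j. prox_min (\<epsilon> (Suc j)) (($) (\<eta> j)) (X j)" "\<And>j. \<eta> (Suc j) = vec m (L (X j))"
    by metis
  obtain u where u: "is_arg_min F (\<lambda>M. M \<in> K) u" using F_minimizer_exists by blast
  have "\<eta> 0 = \<eta>0" using \<eta> by (simp add: prox_sequence_def)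
  then have "\<exists>M. is_arg_min F (\<lambda>M. M \<in> K) M \<and> (\<forall>i<m. (\<lambda>j. \<eta> j $ i) \<longlonglongrightarrow> L M i)"
    using pos(1) X(2)
    by (intro prox_sequence_convergent[of "\<lambda>j. \<epsilon> (Suc j)" "\<lambda>j. ($) (\<eta> j)", OF e _ X(1) _ diverge u])
      (simp_all add: pos_vec_def)
  then obtain M where M: "is_arg_min F (\<lambda>M. M \<in> K) M" "\<forall>i<m. (\<lambda>j. \<eta> j $ i) \<longlonglongrightarrow> L M i" by blast
  then have "vec_tendsto m \<eta> (vec m (L M))" by (simp add: vec_tendsto_def)
  then show ?thesis using reduced_cost_minimizer[OF M(1)] by blast
qed

lemma prox_step_solution:
  assumes w: "pos_vec m w"
  shows "\<exists>M. is_arg_min (flow_cost n T ps A \<rho> w) (flow_constraints n T ps \<rho>) M \<and>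
    (\<forall>N. is_arg_min (flow_cost n T ps A \<rho> w) (flow_constraints n T ps \<rho>) N \<longrightarrow> (\<forall>t<T. N t = M t)) \<and>
    prox_argmin m (reduced_cost n T ps A \<rho>) 1 w = {hid_marginal n ps M}"
proof -
  have wpos: "0 < w $ i" if "i < m" for i using w that by (simp add: pos_vec_def)
  have one: "0 < (1 :: real)" by simp
  obtain M where M: "prox_min 1 (($) w) M" "prox_argmin m (reduced_cost n T ps A \<rho>) 1 w = {vec m (L M)}"
    using prox_argmin_step[OF w one] by blast
  have unique: "\<forall>t<T. N t = M t" if "prox_min 1 (($) w) N" for N
    using prox_min_unique_flow[of 1 "($) w" N M] wpos that M(1) by simp
  have marginal: "hid_marginal n ps M = vec m (L M)"
    by (rule hid_marginal_eq[OF K_D(1)[OF prox_minD(1)[OF M(1)]]])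
  show ?thesis
    unfolding flow_minimizer_iff[OF w]
    by (rule exI[of _ M], unfold marginal) (use M unique in blast)
qed

end

theorem proposition3:
  fixes n T :: nat and ps :: "nat list"
    and A :: "nat \<Rightarrow> real mat" and \<rho> :: "nat \<Rightarrow> real vec"
    and \<eta>0 :: "real vec" and \<epsilon> :: "nat \<Rightarrow> real"
  defines "m \<equiv> n - length ps"
  defines "f \<equiv> reduced_cost n T ps A \<rho>"
  assumes "n \<ge> 1" and "T \<ge> 1"
    and "\<And>t. t < T \<Longrightarrow> row_stochastic n (A t)"
    and "distinct ps" and "set ps \<subseteq> {..<n}"
    and "\<And>t. t \<le> T \<Longrightarrow> \<rho> t \<in> carrier_vec (length ps)"
    and "\<exists>M. feasible_P n T ps A \<rho> M \<and>
           (\<forall>t<T. \<forall>i<n. \<forall>j<n. A t $$ (i, j) > 0 \<longrightarrow> M t $$ (i, j) > 0)"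
    and "pos_vec m \<eta>0"
    and "\<And>j. j \<ge> 1 \<Longrightarrow> \<epsilon> j > 0"
  shows "(\<exists>\<eta>. prox_sequence m f \<epsilon> \<eta>0 \<eta>) \<and>
    (\<forall>\<eta>. prox_sequence m f \<epsilon> \<eta>0 \<eta> \<longrightarrow>
       (\<not> summable (\<lambda>j. 1 / \<epsilon> (Suc j)) \<longrightarrow>
          (\<exists>\<eta>s. is_arg_min f (\<lambda>x. x \<in> carrier_vec m) \<eta>s \<and> vec_tendsto m \<eta> \<eta>s)) \<and>
       (\<forall>j. \<exists>M.
          is_arg_min (flow_cost n T ps A \<rho> (\<eta> j)) (flow_constraints n T ps \<rho>) M \<and>
          (\<forall>N. is_arg_min (flow_cost n T ps A \<rho> (\<eta> j)) (flow_constraints n T ps \<rho>) N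
             \<longrightarrow> (\<forall>t<T. N t = M t)) \<and>
          prox_argmin m f 1 (\<eta> j) = {hid_marginal n ps M}))"
proof -
  obtain M0 where M0: "feasible_P n T ps A \<rho> M0"
    "\<forall>t<T. \<forall>i<n. \<forall>j<n. A t $$ (i, j) > 0 \<longrightarrow> M0 t $$ (i, j) > 0" using assms by blast
  interpret flow_problem n T ps A \<rho> M0
    by unfold_locales (use assms M0 in auto)
  have m: "m = flow_problem.m n ps" by (simp add: assms(1) m_def)
  note pos = \<open>pos_vec m \<eta>0\<close>[unfolded m] and e = assms(11)
  show ?thesis
    unfolding m f_def
  proof (intro conjI allI impI)
    show "\<exists>\<eta>. prox_sequence local.m (reduced_cost n T ps A \<rho>) \<epsilon> \<eta>0 \<eta>"
      by (rule prox_sequence_exists[OF pos e])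
    fix \<eta> assume \<eta>: "prox_sequence local.m (reduced_cost n T ps A \<rho>) \<epsilon> \<eta>0 \<eta>"
    show "\<exists>\<eta>s. is_arg_min (reduced_cost n T ps A \<rho>) (\<lambda>x. x \<in> carrier_vec local.m) \<eta>s
        \<and> vec_tendsto local.m \<eta> \<eta>s" if "\<not> summable (\<lambda>j. 1 / \<epsilon> (Suc j))"
      by (rule prox_sequence_converges[OF \<eta> pos e that])
    have "pos_vec local.m (\<eta> j)" for j by (rule prox_sequence_pos[OF \<eta> pos e])
    then show "\<exists>M. is_arg_min (flow_cost n T ps A \<rho> (\<eta> j)) (flow_constraints n T ps \<rho>) M \<and>
        (\<forall>N. is_arg_min (flow_cost n T ps A \<rho> (\<eta> j)) (flow_constraints n T ps \<rho>) N
           \<longrightarrow> (\<forall>t<T. N t = M t)) \<and>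
        prox_argmin local.m (reduced_cost n T ps A \<rho>) 1 (\<eta> j) = {hid_marginal n ps M}" for j
      by (rule prox_step_solution)
  qed
qed

end
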